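(* Fix $c\in(0,1)$, let $S:=[-1,-c)\cup(c,1]$, define $h_1:=\chi_S$ and recursively for $n\ge2$ $$h_n(\gamma):=\int_{\mathbb{R}} h_{n-1}(t)\,\chi_S\Big(\frac{\gamma}{|t|}\Big)\,dt,\qquad\gamma\in\mathbb{R},$$ and let $Q_n:=\int_{\mathbb{R}}h_n(\gamma)\,d\gamma$. Let $n\ge2$ be an integer, fix $b\in(0,c^{n-1}/2]$, and define $\psi,\widetilde\psi\in L^2(\mathbb{R})$ by $\widehat\psi:=h_n$ and $$\widehat{\widetilde\psi}(\gamma):=\frac{b}{Q_{n-1}^2}\sum_{j=-n+1}^{n-1}h_n(c^j\gamma),\qquad\gamma\in\mathbb{R}.$$ Then $\{D_{c^j}T_{kb}\psi\}_{j,k\in\mathbb{Z}}$ and $\{D_{c^j}T_{kb}\widetilde\psi\}_{j,k\in\mathbb{Z}}$ are dual wavelet frames for $L^2(\mathbb{R})$.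
   Context: $\chi_S$ is the indicator function of $S$. The Fourier transform is $\widehat f(\gamma)=\int_{\mathbb{R}^d} f(x)e^{-2\pi i x\cdot\gamma}\,dx$ on $L^1(\mathbb{R}^d)$, extended to $L^2(\mathbb{R}^d)$ as usual. For an invertible real $d\times d$ matrix $A$, $(D_Af)(x):=|\det A|^{1/2}f(Ax)$; for $\nu\in\mathbb{R}^d$, $(T_\nu f)(x):=f(x-\nu)$ (here $d=1$ and $D_{c^j}f(x)=c^{j/2}f(c^jx)$). A family $\{f_i\}$ in $L^2$ is a frame if there are $A',B'>0$ with $A'\|f\|_2^2\le\sum_i|\langle f,f_i\rangle|^2\le B'\|f\|_2^2$ for all $f$; a Bessel sequence if the upper inequality holds. Two Bessel sequences $\{D_{c^j}T_{kb}\psi\}$ and $\{D_{c^j}T_{kb}\widetilde\psi\}$ are dual frames if $f=\sum_{j,k}\langle f,D_{c^j}T_{kb}\widetilde\psi\rangle D_{c^j}T_{kb}\psi$ for all $f\in L^2(\mathbb{R})$. *)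

theory Defs
  imports "HOL-Analysis.Analysis"
begin

definition sq_int :: "(real \<Rightarrow> complex) \<Rightarrow> bool" where
  "sq_int f \<longleftrightarrow> f \<in> borel_measurable lborel \<and> integrable lborel (\<lambda>x. (cmod (f x))\<^sup>2)"

definition l2_inner :: "(real \<Rightarrow> complex) \<Rightarrow> (real \<Rightarrow> complex) \<Rightarrow> complex" where
  "l2_inner f g = (LINT x|lborel. f x * cnj (g x))"

definition l2_norm :: "(real \<Rightarrow> complex) \<Rightarrow> real" where
  "l2_norm f = sqrt (LINT x|lborel. (cmod (f x))\<^sup>2)"

definition dil :: "real \<Rightarrow> int \<Rightarrow> (real \<Rightarrow> complex) \<Rightarrow> real \<Rightarrow> complex" where
  "dil c j f = (\<lambda>x. complex_of_real (c powr (real_of_int j / 2)) * f (c powr (real_of_int j) * x))"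

definition transl :: "real \<Rightarrow> (real \<Rightarrow> complex) \<Rightarrow> real \<Rightarrow> complex" where
  "transl v f = (\<lambda>x. f (x - v))"

definition bessel_seq :: "('i \<Rightarrow> real \<Rightarrow> complex) \<Rightarrow> bool" where
  "bessel_seq \<Phi> \<longleftrightarrow> (\<forall>i. sq_int (\<Phi> i)) \<and>
     (\<exists>B>0. \<forall>f. sq_int f \<longrightarrow>
        (\<lambda>i. (cmod (l2_inner f (\<Phi> i)))\<^sup>2) summable_on UNIV \<and>
        (\<Sum>\<^sub>\<infinity>i. (cmod (l2_inner f (\<Phi> i)))\<^sup>2) \<le> B * (l2_norm f)\<^sup>2)"

definition dual_frames :: "('i \<Rightarrow> real \<Rightarrow> complex) \<Rightarrow> ('i \<Rightarrow> real \<Rightarrow> complex) \<Rightarrow> bool" where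
  "dual_frames \<Phi> \<Psi> \<longleftrightarrow> bessel_seq \<Phi> \<and> bessel_seq \<Psi> \<and>
     (\<forall>f. sq_int f \<longrightarrow> (\<forall>\<epsilon>>0. \<exists>F0. finite F0 \<and> (\<forall>F. finite F \<and> F0 \<subseteq> F \<longrightarrow>
        l2_norm (\<lambda>x. f x - (\<Sum>i\<in>F. l2_inner f (\<Psi> i) * \<Phi> i x)) < \<epsilon>)))"

definition Sset :: "real \<Rightarrow> real set" where
  "Sset c = {-1..<-c} \<union> {c<..1}"

fun hfun :: "real \<Rightarrow> nat \<Rightarrow> real \<Rightarrow> real" where
  "hfun c 0 = (\<lambda>_. 0)"
| "hfun c (Suc 0) = indicator (Sset c)"
| "hfun c (Suc (Suc n)) = (\<lambda>\<gamma>. LINT t|lborel. hfun c (Suc n) t * indicator (Sset c) (\<gamma> / \<bar>t\<bar>))"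

definition Qnum :: "real \<Rightarrow> nat \<Rightarrow> real" where
  "Qnum c n = (LINT \<gamma>|lborel. hfun c n \<gamma>)"

text \<open>Inverse Fourier transform of an L1 function: the L2 function whose Fourier transform is g
  (for g in L1 \<inter> L2 the L2-inverse Fourier transform agrees a.e. with this integral).\<close>

definition inv_fourier :: "(real \<Rightarrow> complex) \<Rightarrow> real \<Rightarrow> complex" where
  "inv_fourier g = (\<lambda>x. LINT \<gamma>|lborel. g \<gamma> * cis (2 * pi * x * \<gamma>))"

definition psi_hat :: "real \<Rightarrow> nat \<Rightarrow> real \<Rightarrow> complex" where
  "psi_hat c n = (\<lambda>\<gamma>. complex_of_real (hfun c n \<gamma>))"

definition psit_hat :: "real \<Rightarrow> nat \<Rightarrow> real \<Rightarrow> real \<Rightarrow> complex" where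
  "psit_hat c n b = (\<lambda>\<gamma>. complex_of_real (b / (Qnum c (n - 1))\<^sup>2 *
      (\<Sum>j\<in>{- int n + 1 .. int n - 1}. hfun c n (c powr (real_of_int j) * \<gamma>))))"

end

theory Submission
  imports Defs
begin

text \<open>The dilates of \<^term>\<open>Sset c\<close> tile the punctured line, so
  \<open>\<Sum>\<^sub>j h\<^sub>n(c\<^sup>j \<gamma>) = Q\<^sub>n\<^sub>-\<^sub>1\<close> for \<open>\<gamma> \<noteq> 0\<close>, and
  \<open>h\<^sub>n(c\<^sup>j \<gamma>) h\<^sub>n(c\<^sup>l \<gamma>)\<close> vanishes unless \<open>\<bar>j - l\<bar> < n\<close>. Hence
  \<open>\<Sum>\<^sub>j \<psi>\<^sub>h(c\<^sup>j \<gamma>) \<psi>\<^sub>t(c\<^sup>j \<gamma>) = b\<close> for the Fourier transforms \<open>\<psi>\<^sub>h\<close>, \<open>\<psi>\<^sub>t\<close> of the two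
  generators, while the bound on \<open>b\<close> puts both supports in an interval of length \<open>1 / b\<close>, on
  which the translates become a Fourier basis. Parseval on each dilation level then gives the Bessel
  bounds and the weak expansion
  \<open>\<Sum>\<^sub>i \<langle>g, \<psi>\<^sub>t\<^sub>,\<^sub>i\<rangle> \<langle>\<psi>\<^sub>h\<^sub>,\<^sub>i, u\<rangle> = \<langle>g, u\<rangle>\<close>
  for bounded \<open>g\<close>, \<open>u\<close> of compact support. The Fourier transform on \<open>L\<^sup>2\<close> is never needed: Plancherel
  for such functions and the density of their inverse Fourier transforms suffice.\<close>

section \<open>Square-integrable functions\<close>

text \<open>Both facts about the dilates of \<open>h\<^sub>n\<close> come from the recursion. In the
  integral for \<open>h\<^sub>n(c\<^sup>j \<gamma>)\<close> the indicator of \<open>S\<close> is 1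
  for exactly one \<open>j\<close> at each relevant \<open>t\<close>, so summing over
  \<open>j\<close> leaves the integral of \<open>h\<^sub>n\<^sub>-\<^sub>1\<close>. Each recursion
  step also widens the support by one factor \<open>c\<close>, up to
  \<open>c^n < |x| \<le> 1\<close>, which is \<open>n\<close> consecutive dilates of
  \<open>S\<close>. Hence the range -n+1..n-1 in the second generator: wherever
  \<open>h\<^sub>n\<close> is nonzero, it catches every nonzero dilate, and the second generator
  equals the constant \<open>b / Q\<close>. One factor \<open>Q\<close> of the square is cancelled
  by this inner sum, the other by the outer sum over levels. The widest dilate in the range reaches
  out to \<open>c^(1-n)\<close>, and requiring this to be at most \<open>1 / (2 b)\<close> is the
  hypothesis on \<open>b\<close>.

  The obstacle is that \<open>inv_fourier\<close> is an integral, meaningful on integrable functions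
  only, while the conclusion speaks of all square-integrable \<open>f\<close> and of unconditional
  convergence in norm. So the weak expansion is upgraded to norm convergence for nice functions,
  with constants depending only on the Bessel bound, before passing to general
  \<open>f\<close>.\<close>

lemma borel_measurable_cnj [measurable]:
  "f \<in> borel_measurable M \<Longrightarrow> (\<lambda>x. cnj (f x)) \<in> borel_measurable M"
  by (rule borel_measurable_continuous_on[where f = cnj]) (auto intro: continuous_intros)

lemma sq_int_measurable [measurable_dest]: "sq_int f \<Longrightarrow> f \<in> borel_measurable borel"
  by (simp add: sq_int_def)

lemma sq_int_integrable: "sq_int f \<Longrightarrow> integrable lborel (\<lambda>x. (cmod (f x))\<^sup>2)"
  by (simp add: sq_int_def)

lemma sq_int_integrable_mult:
  assumes "sq_int f" "sq_int g"
  shows "integrable lborel (\<lambda>x. f x * cnj (g x))"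
proof (rule Bochner_Integration.integrable_bound)
  note [measurable] = assms[THEN sq_int_measurable]
  show "integrable lborel (\<lambda>x. (cmod (f x))\<^sup>2 + (cmod (g x))\<^sup>2)"
    using assms[THEN sq_int_integrable] by simp
  show "(\<lambda>x. f x * cnj (g x)) \<in> borel_measurable lborel" by measurable
  show "AE x in lborel. norm (f x * cnj (g x)) \<le> norm ((cmod (f x))\<^sup>2 + (cmod (g x))\<^sup>2)"
  proof (rule AE_I2)
    fix x
    have "2 * (cmod (f x) * cmod (g x)) \<le> (cmod (f x))\<^sup>2 + (cmod (g x))\<^sup>2"
      using sum_squares_bound[of "cmod (f x)" "cmod (g x)"] by simp
    moreover have "0 \<le> cmod (f x) * cmod (g x)" by simp
    ultimately have "cmod (f x) * cmod (g x) \<le> (cmod (f x))\<^sup>2 + (cmod (g x))\<^sup>2" by linarith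
    then show "norm (f x * cnj (g x)) \<le> norm ((cmod (f x))\<^sup>2 + (cmod (g x))\<^sup>2)"
      by (simp add: norm_mult)
  qed
qed

lemma sq_int_zero [simp]: "sq_int (\<lambda>x. 0)"
  by (simp add: sq_int_def)

lemma sq_int_cmult: "sq_int f \<Longrightarrow> sq_int (\<lambda>x. a * f x)"
  by (auto simp: sq_int_def norm_mult power_mult_distrib)

lemma sq_int_add:
  assumes "sq_int f" "sq_int g"
  shows "sq_int (\<lambda>x. f x + g x)"
  unfolding sq_int_def
proof (intro conjI)
  note [measurable] = assms[THEN sq_int_measurable]
  show "(\<lambda>x. f x + g x) \<in> borel_measurable lborel" by measurable
  show "integrable lborel (\<lambda>x. (cmod (f x + g x))\<^sup>2)"
  proof (rule Bochner_Integration.integrable_bound)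
    show "integrable lborel (\<lambda>x. 2 * (cmod (f x))\<^sup>2 + 2 * (cmod (g x))\<^sup>2)"
      using assms[THEN sq_int_integrable] by simp
    show "(\<lambda>x. (cmod (f x + g x))\<^sup>2) \<in> borel_measurable lborel" by measurable
    show "AE x in lborel. norm ((cmod (f x + g x))\<^sup>2) \<le> norm (2 * (cmod (f x))\<^sup>2 + 2 * (cmod (g x))\<^sup>2)"
    proof (rule AE_I2)
      fix x
      have "(cmod (f x + g x))\<^sup>2 \<le> (cmod (f x) + cmod (g x))\<^sup>2"
        by (intro power_mono norm_triangle_ineq) simp
      also have "\<dots> \<le> 2 * (cmod (f x))\<^sup>2 + 2 * (cmod (g x))\<^sup>2"
        using sum_squares_bound[of "cmod (f x)" "cmod (g x)"] by (simp add: power2_sum)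
      finally show "norm ((cmod (f x + g x))\<^sup>2) \<le> norm (2 * (cmod (f x))\<^sup>2 + 2 * (cmod (g x))\<^sup>2)"
        by simp
    qed
  qed
qed

lemma sq_int_diff: "sq_int f \<Longrightarrow> sq_int g \<Longrightarrow> sq_int (\<lambda>x. f x - g x)"
  using sq_int_add[of f "\<lambda>x. - 1 * g x"] sq_int_cmult[of g "- 1"] by simp

lemma sq_int_sum: "(\<And>i. i \<in> F \<Longrightarrow> sq_int (f i)) \<Longrightarrow> sq_int (\<lambda>x. \<Sum>i\<in>F. f i x)"
  by (induction F rule: infinite_finite_induct) (auto intro: sq_int_add)

section \<open>Norm and inner product of square-integrable functions\<close>

lemma l2_norm_nonneg [simp]: "0 \<le> l2_norm f"
  by (simp add: l2_norm_def)

lemma l2_norm_sq: "(l2_norm f)\<^sup>2 = (LINT x|lborel. (cmod (f x))\<^sup>2)"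
  by (simp add: l2_norm_def)

lemma l2_inner_self: "l2_inner f f = complex_of_real ((l2_norm f)\<^sup>2)"
  unfolding l2_inner_def l2_norm_sq complex_norm_square[symmetric] integral_complex_of_real ..

lemma l2_inner_commute: "l2_inner g f = cnj (l2_inner f g)"
  unfolding l2_inner_def by (simp flip: Bochner_Integration.integral_cnj add: mult.commute)

lemma l2_inner_cmult_left: "l2_inner (\<lambda>x. a * f x) g = a * l2_inner f g"
  unfolding l2_inner_def by (simp add: mult.assoc)

lemma l2_inner_cmult_right: "l2_inner f (\<lambda>x. a * g x) = cnj a * l2_inner f g"
  by (metis complex_cnj_mult l2_inner_cmult_left l2_inner_commute)

lemma l2_inner_add_left:
  "sq_int f \<Longrightarrow> sq_int g \<Longrightarrow> sq_int h \<Longrightarrow> l2_inner (\<lambda>x. f x + g x) h = l2_inner f h + l2_inner g h"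
  unfolding l2_inner_def
  by (simp add: distrib_right sq_int_integrable_mult)

lemma l2_inner_add_right:
  "sq_int f \<Longrightarrow> sq_int g \<Longrightarrow> sq_int h \<Longrightarrow> l2_inner h (\<lambda>x. f x + g x) = l2_inner h f + l2_inner h g"
  by (metis complex_cnj_add l2_inner_add_left l2_inner_commute)

lemma l2_inner_diff_left:
  "sq_int f \<Longrightarrow> sq_int g \<Longrightarrow> sq_int h \<Longrightarrow> l2_inner (\<lambda>x. f x - g x) h = l2_inner f h - l2_inner g h"
  unfolding l2_inner_def
  by (simp add: left_diff_distrib sq_int_integrable_mult)

lemma l2_inner_zero_left [simp]: "l2_inner (\<lambda>x. 0) g = 0"
  by (simp add: l2_inner_def)

lemma l2_inner_sum_left:
  assumes "\<And>i. i \<in> F \<Longrightarrow> sq_int (f i)" "sq_int g"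
  shows "l2_inner (\<lambda>x. \<Sum>i\<in>F. f i x) g = (\<Sum>i\<in>F. l2_inner (f i) g)"
  using assms by (induction F rule: infinite_finite_induct) (auto simp: l2_inner_add_left sq_int_sum)

lemma l2_inner_sum_right:
  assumes "\<And>i. i \<in> F \<Longrightarrow> sq_int (f i)" "sq_int g"
  shows "l2_inner g (\<lambda>x. \<Sum>i\<in>F. f i x) = (\<Sum>i\<in>F. l2_inner g (f i))"
  by (subst l2_inner_commute, subst l2_inner_sum_left) (use assms in \<open>auto simp: l2_inner_commute[of g]\<close>)

lemma l2_norm_sq_add:
  assumes "sq_int f" "sq_int g"
  shows "(l2_norm (\<lambda>x. f x + g x))\<^sup>2 = (l2_norm f)\<^sup>2 + 2 * Re (l2_inner f g) + (l2_norm g)\<^sup>2"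
proof -
  have "complex_of_real ((l2_norm (\<lambda>x. f x + g x))\<^sup>2)
      = l2_inner f f + l2_inner f g + (cnj (l2_inner f g) + l2_inner g g)"
    unfolding l2_inner_self[symmetric]
    by (simp add: l2_inner_add_left l2_inner_add_right assms sq_int_add flip: l2_inner_commute)
  from arg_cong[OF this, of Re] show ?thesis by (simp add: l2_inner_self)
qed

lemma l2_norm_cmult: "l2_norm (\<lambda>x. a * f x) = cmod a * l2_norm f"
  unfolding l2_norm_def by (simp add: norm_mult power_mult_distrib real_sqrt_mult)

lemma l2_norm_sq_diff:
  assumes "sq_int f" "sq_int g"
  shows "(l2_norm (\<lambda>x. f x - g x))\<^sup>2 = (l2_norm f)\<^sup>2 - 2 * Re (l2_inner f g) + (l2_norm g)\<^sup>2"
  using l2_norm_sq_add[OF assms(1) sq_int_cmult[OF assms(2), of "- 1"]]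
    l2_norm_cmult[of "- 1" g] l2_inner_cmult_right[of f "- 1" g] by simp

text \<open>Integrates the pointwise inequality given by the square of \<open>G |f| - F |g|\<close>,
  where \<open>F\<close> and \<open>G\<close> are the two norms. Enlarging both by
  \<open>d > 0\<close> permits the divisions; \<open>d\<close> tends to 0 at the end.\<close>

lemma l2_Cauchy_Schwarz:
  assumes "sq_int f" "sq_int g"
  shows "cmod (l2_inner f g) \<le> l2_norm f * l2_norm g"
proof -
  note [measurable] = assms[THEN sq_int_measurable]
  have "cmod (l2_inner f g) \<le> (l2_norm f + d) * (l2_norm g + d)" if d: "0 < d" for d
  proof -
    define F where "F = l2_norm f + d"
    define G where "G = l2_norm g + d"
    have pos: "F > 0" "G > 0" using d by (auto simp: F_def G_def add_nonneg_pos)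
    have "cmod (l2_inner f g) \<le> (LINT x|lborel. cmod (f x) * cmod (g x))"
      unfolding l2_inner_def using integral_norm_bound[of lborel "\<lambda>x. f x * cnj (g x)"]
      by (simp add: norm_mult)
    also have "\<dots> \<le> (LINT x|lborel. (G / F * (cmod (f x))\<^sup>2 + F / G * (cmod (g x))\<^sup>2) / 2)"
    proof (rule integral_mono)
      show "integrable lborel (\<lambda>x. cmod (f x) * cmod (g x))"
        using integrable_norm[OF sq_int_integrable_mult[OF assms]] by (simp add: norm_mult)
      show "integrable lborel (\<lambda>x. (G / F * (cmod (f x))\<^sup>2 + F / G * (cmod (g x))\<^sup>2) / 2)"
        using assms[THEN sq_int_integrable] by simp
      fix x
      have "0 \<le> (G * cmod (f x) - F * cmod (g x))\<^sup>2 / (F * G)" using pos by simp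
      also have "\<dots> = G / F * (cmod (f x))\<^sup>2 + F / G * (cmod (g x))\<^sup>2 - 2 * (cmod (f x) * cmod (g x))"
        using pos by (simp add: power2_eq_square field_simps)
      finally show "cmod (f x) * cmod (g x) \<le> (G / F * (cmod (f x))\<^sup>2 + F / G * (cmod (g x))\<^sup>2) / 2"
        by simp
    qed
    also have "\<dots> = (G / F * (l2_norm f)\<^sup>2 + F / G * (l2_norm g)\<^sup>2) / 2"
      using assms[THEN sq_int_integrable] by (simp add: l2_norm_sq)
    also have "\<dots> \<le> (G / F * F\<^sup>2 + F / G * G\<^sup>2) / 2"
      using pos d by (intro divide_right_mono add_mono mult_left_mono power_mono) (auto simp: F_def G_def)
    also have "\<dots> = F * G" using pos by (simp add: power2_eq_square)
    finally show ?thesis by (simp add: F_def G_def)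
  qed
  moreover have "((\<lambda>d. (l2_norm f + d) * (l2_norm g + d)) \<longlongrightarrow> (l2_norm f + 0) * (l2_norm g + 0)) (at_right 0)"
    by (intro tendsto_intros)
  ultimately show ?thesis
    by (intro tendsto_lowerbound[of _ "l2_norm f * l2_norm g" "at_right 0"])
      (auto intro!: eventually_at_rightI[of 0 1])
qed

lemma l2_norm_triangle:
  assumes "sq_int f" "sq_int g"
  shows "l2_norm (\<lambda>x. f x + g x) \<le> l2_norm f + l2_norm g"
proof (rule power2_le_imp_le)
  have "Re (l2_inner f g) \<le> l2_norm f * l2_norm g"
    using l2_Cauchy_Schwarz[OF assms] complex_Re_le_cmod order_trans by blast
  then show "(l2_norm (\<lambda>x. f x + g x))\<^sup>2 \<le> (l2_norm f + l2_norm g)\<^sup>2"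
    by (simp add: l2_norm_sq_add assms power2_sum)
qed simp

text \<open>Turns identities between norms into identities between inner products. Parseval and
  Plancherel are both proved for norms first.\<close>

lemma polarization:
  fixes a b :: complex
  shows "a * cnj b = (complex_of_real ((cmod (a + b))\<^sup>2) - complex_of_real ((cmod (a - b))\<^sup>2)
    + \<i> * complex_of_real ((cmod (a + \<i> * b))\<^sup>2) - \<i> * complex_of_real ((cmod (a - \<i> * b))\<^sup>2)) / 4"
  unfolding cmod_power2 by (auto simp: complex_eq_iff power2_eq_square algebra_simps)

lemma l2_inner_polarization:
  assumes "sq_int f" "sq_int g"
  shows "l2_inner f g = (complex_of_real ((l2_norm (\<lambda>x. f x + g x))\<^sup>2) - complex_of_real ((l2_norm (\<lambda>x. f x - g x))\<^sup>2)
    + \<i> * complex_of_real ((l2_norm (\<lambda>x. f x + \<i> * g x))\<^sup>2) - \<i> * complex_of_real ((l2_norm (\<lambda>x. f x - \<i> * g x))\<^sup>2)) / 4"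
proof -
  have ig: "sq_int (\<lambda>x. \<i> * g x)" using assms by (rule_tac sq_int_cmult)
  show ?thesis
    by (simp add: l2_norm_sq_add l2_norm_sq_diff assms ig l2_norm_cmult l2_inner_cmult_right
        complex_eq_iff)
qed

text \<open>The working class on the frequency side: it lies in L1 and in L2, so
  \<open>inv_fourier\<close> converges absolutely on it, and it is closed under sums, products,
  conjugation, modulation and dilation.\<close>

definition bdd_supp :: "(real \<Rightarrow> complex) \<Rightarrow> bool" where
  "bdd_supp g \<longleftrightarrow> g \<in> borel_measurable borel \<and> (\<exists>M R. \<forall>x. cmod (g x) \<le> M * indicator {-R..R} x)"

lemma bdd_supp_measurable [measurable_dest]: "bdd_supp g \<Longrightarrow> g \<in> borel_measurable borel"
  by (simp add: bdd_supp_def)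

lemma bdd_suppE:
  assumes "bdd_supp g"
  obtains M R where "0 < M" "0 < R" "\<And>x. cmod (g x) \<le> M * indicator {-R..R} x"
proof -
  obtain M R where MR: "\<And>x. cmod (g x) \<le> M * indicator {-R..R} x"
    using assms by (auto simp: bdd_supp_def)
  have "cmod (g x) \<le> max 1 M * indicator {- max 1 R..max 1 R} x" for x
    by (rule order_trans[OF MR]) (auto simp: indicator_def)
  then show ?thesis by (intro that[of "max 1 M" "max 1 R"]) auto
qed

lemma bdd_supp_integrable:
  assumes "bdd_supp g" shows "integrable lborel g"
proof -
  note [measurable] = bdd_supp_measurable[OF assms]
  obtain M R where MR: "\<And>x. cmod (g x) \<le> M * indicator {-R..R} x" "0 < M"
    using bdd_suppE[OF assms] by metis
  show ?thesis
  proof (rule Bochner_Integration.integrable_bound)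
    show "integrable lborel (\<lambda>x. M * indicator {-R..R} x :: real)"
      by (intro integrable_mult_right integrable_real_indicator) (auto simp: emeasure_lborel_Icc_eq)
    show "AE x in lborel. cmod (g x) \<le> norm (M * indicator {-R..R} x)"
      using MR by (intro AE_I2) (simp add: order_trans[OF MR(1)])
  qed measurable
qed

lemma bdd_supp_mult_bounded:
  assumes "bdd_supp g" "h \<in> borel_measurable borel" "\<And>x. cmod (h x) \<le> C"
  shows "bdd_supp (\<lambda>x. g x * h x)"
proof -
  note [measurable] = bdd_supp_measurable[OF assms(1)] assms(2)
  obtain M R where MR: "\<And>x. cmod (g x) \<le> M * indicator {-R..R} x" "0 < M"
    using bdd_suppE[OF assms(1)] by metis
  have "cmod (g x * h x) \<le> M * C * indicator {-R..R} x" for x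
    using mult_mono[OF MR(1)[of x] assms(3)[of x]] MR(2) by (simp add: norm_mult mult_ac)
  then show ?thesis unfolding bdd_supp_def by (intro conjI) (measurable, blast)
qed

lemma bdd_supp_bounded:
  assumes "bdd_supp g" obtains C where "0 < C" "\<And>x. cmod (g x) \<le> C"
proof -
  obtain M R where MR: "\<And>x. cmod (g x) \<le> M * indicator {-R..R} x" "0 < M"
    using bdd_suppE[OF assms] by metis
  then show ?thesis
    by (intro that[of M]) (auto simp: indicator_def intro!: order_trans[OF MR(1)])
qed

lemma bdd_supp_mult:
  assumes "bdd_supp g" "bdd_supp h" shows "bdd_supp (\<lambda>x. g x * h x)"
proof -
  obtain C where "\<And>x. cmod (h x) \<le> C" using bdd_supp_bounded[OF assms(2)] by metis
  with assms show ?thesis by (intro bdd_supp_mult_bounded) auto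
qed

lemma bdd_supp_cnj: "bdd_supp g \<Longrightarrow> bdd_supp (\<lambda>x. cnj (g x))"
  by (auto simp: bdd_supp_def)

lemma bdd_supp_cmult: "bdd_supp g \<Longrightarrow> bdd_supp (\<lambda>x. a * g x)"
  using bdd_supp_mult_bounded[of g "\<lambda>_. a" "cmod a"] by (simp add: mult.commute)

lemma bdd_supp_add:
  assumes "bdd_supp g" "bdd_supp h" shows "bdd_supp (\<lambda>x. g x + h x)"
proof -
  note [measurable] = assms[THEN bdd_supp_measurable]
  obtain M R where MR: "\<And>x. cmod (g x) \<le> M * indicator {-R..R} x" "0 < M"
    using bdd_suppE[OF assms(1)] by metis
  obtain M' R' where MR': "\<And>x. cmod (h x) \<le> M' * indicator {-R'..R'} x" "0 < M'"
    using bdd_suppE[OF assms(2)] by metis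
  have "cmod (g x + h x) \<le> (M + M') * indicator {- max R R'..max R R'} x" for x
  proof -
    have "cmod (g x + h x) \<le> M * indicator {-R..R} x + M' * indicator {-R'..R'} x"
      using MR(1)[of x] MR'(1)[of x] by (intro order_trans[OF norm_triangle_ineq] add_mono)
    also have "\<dots> \<le> (M + M') * indicator {- max R R'..max R R'} x"
      using MR(2) MR'(2) by (auto simp: indicator_def)
    finally show ?thesis .
  qed
  then show ?thesis unfolding bdd_supp_def by (intro conjI) (measurable, blast)
qed

lemma bdd_supp_diff: "bdd_supp g \<Longrightarrow> bdd_supp h \<Longrightarrow> bdd_supp (\<lambda>x. g x - h x)"
  using bdd_supp_add[of g "\<lambda>x. - 1 * h x"] bdd_supp_cmult[of h "- 1"] by simp

lemma bdd_supp_zero: "bdd_supp (\<lambda>x. 0)"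
  unfolding bdd_supp_def by (intro conjI exI[of _ 0]) auto

lemma bdd_supp_sum: "(\<And>i. i \<in> F \<Longrightarrow> bdd_supp (f i)) \<Longrightarrow> bdd_supp (\<lambda>x. \<Sum>i\<in>F. f i x)"
  by (induction F rule: infinite_finite_induct) (auto intro: bdd_supp_add bdd_supp_zero)

lemma bdd_supp_sq_int:
  assumes "bdd_supp g" shows "sq_int g"
proof -
  have "integrable lborel (\<lambda>x. complex_of_real ((cmod (g x))\<^sup>2))"
    using bdd_supp_integrable[OF bdd_supp_mult[OF assms bdd_supp_cnj[OF assms]]]
    by (simp only: complex_norm_square)
  then show ?thesis
    using bdd_supp_measurable[OF assms] by (simp only: sq_int_def complex_of_real_integrable_eq) simp
qed

lemma borel_measurable_cis [measurable]:
  "f \<in> borel_measurable M \<Longrightarrow> (\<lambda>x. cis (f x)) \<in> borel_measurable M"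
  by (rule borel_measurable_continuous_on[where f = cis]) (auto intro: continuous_intros)

lemma bdd_supp_modulate: "bdd_supp g \<Longrightarrow> bdd_supp (\<lambda>x. g x * cis (a * x))"
  by (rule bdd_supp_mult_bounded[where C = 1]) auto

section \<open>Parseval for Fourier series\<close>

text \<open>The minus sign makes the inner product against this exponential a value of
  \<open>inv_fourier\<close> at \<open>k / L\<close>.\<close>

definition trig_mono :: "real \<Rightarrow> int \<Rightarrow> real \<Rightarrow> complex" where
  "trig_mono L k x = cis (- (2 * pi * (real_of_int k / L) * x))"

text \<open>Products are kept out of the rules so that induction directly yields a finite expansion;
  closure under products then follows because frequencies add.\<close>

inductive trig_poly :: "real \<Rightarrow> (real \<Rightarrow> complex) \<Rightarrow> bool" for L where
  trig_poly_mono: "trig_poly L (\<lambda>x. a * trig_mono L k x)"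
| trig_poly_add: "trig_poly L p \<Longrightarrow> trig_poly L q \<Longrightarrow> trig_poly L (\<lambda>x. p x + q x)"

lemma trig_mono_mult: "trig_mono L k x * trig_mono L l x = trig_mono L (k + l) x"
  by (simp add: trig_mono_def cis_mult distrib_left distrib_right add_divide_distrib)

lemma trig_poly_mult:
  assumes "trig_poly L p" "trig_poly L q"
  shows "trig_poly L (\<lambda>x. p x * q x)"
  using assms(1)
proof induction
  case (trig_poly_mono a k)
  show ?case using assms(2)
  proof induction
    case (trig_poly_mono a' k')
    show ?case
      using trig_poly.trig_poly_mono[of L "a * a'" "k + k'"]
      by (simp add: mult_ac flip: trig_mono_mult)
  next
    case (trig_poly_add p q)
    then show ?case by (simp add: distrib_left trig_poly.trig_poly_add)
  qed
next
  case (trig_poly_add p q)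
  then show ?case by (simp add: distrib_right trig_poly.trig_poly_add)
qed

lemma trig_poly_const: "trig_poly L (\<lambda>x. a)"
  using trig_poly_mono[of L a 0] by (simp add: trig_mono_def)

lemma trig_poly_expansion:
  assumes "trig_poly L p"
  obtains K a where "finite K" "\<And>x. p x = (\<Sum>k\<in>K. a k * trig_mono L k x)"
proof -
  have "\<exists>K a. finite K \<and> (\<forall>x. p x = (\<Sum>k\<in>K. a k * trig_mono L k x))"
    using assms
  proof induction
    case (trig_poly_mono a k)
    show ?case by (rule exI[of _ "{k}"], rule exI[of _ "\<lambda>_. a"]) simp
  next
    case (trig_poly_add p q)
    then obtain K a K' a' where fin: "finite K" "finite K'"
      and p: "\<And>x. p x = (\<Sum>k\<in>K. a k * trig_mono L k x)"
      and q: "\<And>x. q x = (\<Sum>k\<in>K'. a' k * trig_mono L k x)" by blast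
    have "p x = (\<Sum>k\<in>K \<union> K'. (if k \<in> K then a k else 0) * trig_mono L k x)"
      "q x = (\<Sum>k\<in>K \<union> K'. (if k \<in> K' then a' k else 0) * trig_mono L k x)" for x
      unfolding p q using fin by (auto intro!: sum.mono_neutral_cong_left)
    then have "p x + q x = (\<Sum>k\<in>K \<union> K'. ((if k \<in> K then a k else 0) + (if k \<in> K' then a' k else 0))
        * trig_mono L k x)" for x
      by (simp only: distrib_right sum.distrib)
    then show ?case using fin
      by (intro exI[of _ "K \<union> K'"] exI[of _ "\<lambda>k. (if k \<in> K then a k else 0) + (if k \<in> K' then a' k else 0)"]) simp
  qed
  then show ?thesis using that by blast
qed

lemma trig_poly_real_polynomial_function:
  fixes p :: "complex \<Rightarrow> real"
  assumes "real_polynomial_function p"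
  shows "trig_poly L (\<lambda>x. complex_of_real (p (cis (2 * pi * x / L))))"
  using assms
proof induction
  case (linear f)
  interpret bounded_linear f by fact
  \<comment> \<open>A real-linear \<open>f\<close> is determined by its values at 1 and at the
    imaginary unit, so \<open>f (cis t) = A cos t + B sin t\<close>; Euler's formulas split this
    into the frequencies 1 and -1.\<close>
  define A where "A = f 1"
  define B where "B = f \<i>"
  let ?a = "Complex (A / 2) (- B / 2)" and ?b = "Complex (A / 2) (B / 2)"
  have "complex_of_real (f (cis t)) = ?a * cis t + ?b * cis (- t)" for t
  proof -
    have "cis t = cos t *\<^sub>R 1 + sin t *\<^sub>R \<i>" by (simp add: complex_eq_iff)
    then have "f (cis t) = cos t * A + sin t * B"
      by (simp only: add scaleR A_def B_def real_scaleR_def)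
    then show ?thesis by (simp add: complex_eq_iff)
  qed
  then have "(\<lambda>x. complex_of_real (f (cis (2 * pi * x / L))))
      = (\<lambda>x. ?a * trig_mono L (- 1) x + ?b * trig_mono L 1 x)"
    by (simp add: trig_mono_def)
  then show ?case by (auto intro: trig_poly_mono trig_poly_add)
next
  case (const c)
  then show ?case by (rule trig_poly_const)
next
  case (add f g)
  then show ?case by (simp add: trig_poly_add)
next
  case (mult f g)
  then show ?case by (simp add: trig_poly_mult)
qed

lemma trig_poly_polynomial_function:
  fixes p :: "complex \<Rightarrow> complex"
  assumes "polynomial_function p"
  shows "trig_poly L (\<lambda>x. p (cis (2 * pi * x / L)))"
proof -
  have "real_polynomial_function (Re \<circ> p)" "real_polynomial_function (Im \<circ> p)"
    using assms bounded_linear_Re bounded_linear_Im by (auto simp: polynomial_function_def)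
  note * = this[THEN trig_poly_real_polynomial_function, of L]
  have "trig_poly L (\<lambda>x. complex_of_real (Re (p (cis (2 * pi * x / L))))
      + \<i> * complex_of_real (Im (p (cis (2 * pi * x / L)))))"
    using * by (intro trig_poly_add trig_poly_mult trig_poly_const) (auto simp: o_def)
  then show ?thesis by (simp flip: complex_eq)
qed

text \<open>For nonnegative terms the unordered sum is the supremum of the finite sums. In the
  application, Bessel's inequality supplies \<open>le\<close> and completeness of the exponentials
  supplies \<open>approx\<close>.\<close>

lemma has_sum_nonneg_realI:
  fixes f :: "'i \<Rightarrow> real"
  assumes nonneg: "\<And>i. 0 \<le> f i"
    and le: "\<And>K. finite K \<Longrightarrow> sum f K \<le> S"
    and approx: "\<And>e. 0 < e \<Longrightarrow> \<exists>K. finite K \<and> S - e < sum f K"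
  shows "(f has_sum S) UNIV"
  unfolding has_sum_def
proof (rule tendstoI)
  fix e :: real assume "0 < e"
  then obtain K where K: "finite K" "S - e < sum f K" using approx by blast
  show "\<forall>\<^sub>F F in finite_subsets_at_top UNIV. dist (sum f F) S < e"
    unfolding eventually_finite_subsets_at_top
  proof (intro exI[of _ K] conjI allI impI)
    fix F assume F: "finite F \<and> K \<subseteq> F \<and> F \<subseteq> UNIV"
    have "sum f K \<le> sum f F" using F nonneg by (intro sum_mono2) auto
    then show "dist (sum f F) S < e"
      using le[of F] F K by (auto simp: dist_real_def)
  qed (use K in auto)
qed

text \<open>A Lebesgue measurable function is an a.e. limit of continuous ones
  (\<open>measurable_on\<close>). The point added here is the uniform bound, which later permits
  dominated convergence.\<close>

lemma ae_continuous_approx: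
  assumes "bdd_supp G" and C: "0 < C" "\<And>x. cmod (G x) \<le> C"
  obtains g :: "nat \<Rightarrow> real \<Rightarrow> complex"
  where "\<And>m. continuous_on UNIV (g m)" "\<And>m x. cmod (g m x) \<le> C"
    "AE x in lborel. (\<lambda>m. g m x) \<longlonglongrightarrow> G x"
proof -
  have "G \<in> borel_measurable lebesgue"
    using bdd_supp_measurable[OF assms(1)] by (simp add: measurable_completion)
  then have "G measurable_on UNIV" by (intro lebesgue_measurable_imp_measurable_on) auto
  then obtain N g where N: "negligible N" and cont: "\<And>m. continuous_on UNIV (g m)"
    and lim: "\<And>x. x \<notin> N \<Longrightarrow> (\<lambda>m. g m x) \<longlonglongrightarrow> G x"
    unfolding measurable_on_def by auto
  \<comment> \<open>Radial retraction onto the closed disc of radius \<open>C\<close>: continuous,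
    and the identity on the values of \<open>G\<close>, so composing with it keeps the
    limits.\<close>
  define q where "q = (\<lambda>y. complex_of_real (C / max C (cmod y)) * y)"
  have q_cont: "continuous_on UNIV q"
    unfolding q_def using C(1) by (intro continuous_intros) (auto simp: max_def)
  have q_bd: "cmod (q y) \<le> C" for y
    using C(1) by (auto simp: q_def norm_mult norm_divide max_def field_simps)
  have q_id: "q (G x) = G x" for x
    using C(1) C(2)[of x] by (simp add: q_def max_absorb1)
  have "AE x in lebesgue. x \<notin> N"
    using N by (intro AE_not_in) (simp add: negligible_iff_null_sets)
  then have "AE x in lborel. x \<notin> N" by (simp add: AE_completion_iff)
  then have "AE x in lborel. (\<lambda>m. q (g m x)) \<longlonglongrightarrow> G x"
  proof eventually_elim
    case (elim x)
    have "isCont q (G x)" using q_cont by (simp add: continuous_on_eq_continuous_at)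
    from isCont_tendsto_compose[OF this lim[OF elim]] show ?case by (simp add: q_id)
  qed
  moreover have "continuous_on UNIV (\<lambda>x. q (g m x))" for m
    using continuous_on_compose2[OF q_cont cont[of m]] by simp
  ultimately show ?thesis using q_bd by (intro that[of "\<lambda>m x. q (g m x)"]) auto
qed

text \<open>The factor \<^term>\<open>min 1 (real m * cmod (z + 1))\<close> removes the jump of the argument at
  \<^term>\<open>- 1 :: complex\<close>, so that the approximants live on the circle.\<close>

lemma trig_poly_ae_approx:
  assumes G: "bdd_supp G" and L: "0 < L"
  obtains p :: "nat \<Rightarrow> real \<Rightarrow> complex" and C :: real
  where "\<And>m. trig_poly L (p m)" "\<And>m x. cmod (p m x) \<le> C"
    "AE x in lborel. x \<in> {-L/2<..<L/2} \<longrightarrow> (\<lambda>m. p m x) \<longlonglongrightarrow> G x"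
proof -
  obtain C where C: "0 < C" "\<And>x. cmod (G x) \<le> C" using bdd_supp_bounded[OF G] by metis
  obtain g :: "nat \<Rightarrow> real \<Rightarrow> complex" where g: "\<And>m. continuous_on UNIV (g m)" "\<And>m x. cmod (g m x) \<le> C"
    and lim: "AE x in lborel. (\<lambda>m. g m x) \<longlonglongrightarrow> G x"
    by (rule ae_continuous_approx[OF G C]) (rule that)
  define h where "h = (\<lambda>m z. complex_of_real (min 1 (real m * cmod (z + 1))) * g m (L * Arg z / (2 * pi)))"
  have h_cont: "continuous_on (sphere 0 1) (h m)" for m
    unfolding continuous_on_eq_continuous_within
  proof
    fix z :: complex assume z: "z \<in> sphere 0 1"
    show "continuous (at z within sphere 0 1) (h m)"
    proof (cases "z = - 1")
      case False
      \<comment> \<open>The only point of the unit circle on the branch cut of \<open>Arg\<close> is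
        -1.\<close>
      have "z \<notin> \<real>\<^sub>\<le>\<^sub>0"
      proof
        assume "z \<in> \<real>\<^sub>\<le>\<^sub>0"
        then obtain r where "z = of_real r" "r \<le> 0" by (auto elim: nonpos_Reals_cases)
        with z False show False by auto
      qed
      then have "isCont (\<lambda>z. L * Arg z / (2 * pi)) z"
        by (intro continuous_intros continuous_at_Arg) auto
      moreover have "isCont (g m) x" for x
        using g(1) by (simp add: continuous_on_eq_continuous_at)
      ultimately have "isCont (\<lambda>z. g m (L * Arg z / (2 * pi))) z"
        by (intro isCont_o2[where f = "\<lambda>z. L * Arg z / (2 * pi)" and g = "g m"])
      then have "isCont (h m) z"
        unfolding h_def by (intro continuous_intros)
      then show ?thesis by (rule continuous_at_imp_continuous_at_within)
    next
      case True
      have "(h m \<longlongrightarrow> 0) (at z within sphere 0 1)"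
      proof (rule Lim_null_comparison)
        show "\<forall>\<^sub>F w in at z within sphere 0 1. norm (h m w) \<le> real m * cmod (w + 1) * C"
        proof (rule always_eventually, rule allI)
          fix w
          show "norm (h m w) \<le> real m * cmod (w + 1) * C"
            unfolding h_def norm_mult using g(2) C(1) by (intro mult_mono) auto
        qed
        have "((\<lambda>w. real m * cmod (w + 1) * C) \<longlongrightarrow> real m * cmod (z + 1) * C) (at z within sphere 0 1)"
          by (intro tendsto_intros)
        then show "((\<lambda>w. real m * cmod (w + 1) * C) \<longlongrightarrow> 0) (at z within sphere 0 1)"
          by (simp add: True)
      qed
      then show ?thesis by (simp add: continuous_within h_def True)
    qed
  qed
  \<comment> \<open>Stone-Weierstrass on the circle; composed with \<open>cis\<close>, a polynomial
    becomes a trigonometric polynomial. The error \<open>1 / (m + 1)\<close> tends to 0 and never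
    exceeds 1, whence the uniform bound \<open>C + 1\<close>.\<close>
  have "\<exists>P. polynomial_function P \<and> (\<forall>z\<in>sphere 0 1. cmod (h m z - P z) < 1 / real (Suc m))" for m
    using Stone_Weierstrass_polynomial_function[OF compact_sphere h_cont] by simp
  then obtain P where P: "\<And>m. polynomial_function (P m)"
    "\<And>m z. cmod z = 1 \<Longrightarrow> cmod (h m z - P m z) < 1 / real (Suc m)"
    by (metis dist_0_norm mem_sphere)
  define p where "p = (\<lambda>m x. P m (cis (2 * pi * x / L)))"
  show ?thesis
  proof (rule that[of p "C + 1"])
    show "trig_poly L (p m)" for m
      unfolding p_def by (rule trig_poly_polynomial_function[OF P(1)])
    show "cmod (p m x) \<le> C + 1" for m x
    proof -
      let ?z = "cis (2 * pi * x / L)"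
      have "cmod (P m ?z) \<le> cmod (h m ?z) + cmod (h m ?z - P m ?z)"
        using norm_triangle_sub[of "P m ?z" "h m ?z"] by (simp add: norm_minus_commute)
      moreover have "cmod (h m ?z) \<le> 1 * C"
        unfolding h_def norm_mult using g(2) C(1) by (intro mult_mono) auto
      moreover have "1 / real (Suc m) \<le> 1" by simp
      ultimately show ?thesis unfolding p_def using P(2)[of ?z m, OF norm_cis] by linarith
    qed
    show "AE x in lborel. x \<in> {-L/2<..<L/2} \<longrightarrow> (\<lambda>m. p m x) \<longlonglongrightarrow> G x"
      using lim
    proof (eventually_elim, safe)
      fix x assume lim: "(\<lambda>m. g m x) \<longlonglongrightarrow> G x" and x: "x \<in> {-L/2<..<L/2}"
      let ?z = "cis (2 * pi * x / L)"
      have rng: "- pi < 2 * pi * x / L" "2 * pi * x / L < pi"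
      proof -
        have "- (L * pi) < (2 * x) * pi" "(2 * x) * pi < L * pi"
          using x by (simp_all only: minus_mult_left mult_less_cancel_right) (auto simp: not_le)
        then show "- pi < 2 * pi * x / L" "2 * pi * x / L < pi"
          using L by (simp_all add: field_simps)
      qed
      then have Arg: "L * Arg ?z / (2 * pi) = x"
        using L by (simp add: Arg_cis)
      \<comment> \<open>At an interior point of the period the damping factor is 1 from some index
        \<open>m0\<close> on, and from there \<open>h m\<close> reproduces
        \<open>g m x\<close>.\<close>
      have "?z \<noteq> - 1"
        using rng Arg_cis[of "2 * pi * x / L"] Arg_cis[of pi] by (auto simp: cis_pi)
      then have "0 < cmod (?z + 1)" by (simp add: add_eq_0_iff2)
      then obtain m0 where m0: "1 < real m0 * cmod (?z + 1)" using reals_Archimedean3 by blast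
      have ev: "h m ?z = g m x" if "m0 \<le> m" for m
      proof -
        have "real m0 * cmod (?z + 1) \<le> real m * cmod (?z + 1)"
          using that by (intro mult_right_mono) auto
        with m0 have "min 1 (real m * cmod (?z + 1)) = 1" by simp
        then show ?thesis unfolding h_def Arg by simp
      qed
      have "(\<lambda>m. h m ?z) \<longlonglongrightarrow> G x"
        by (rule Lim_transform_eventually[OF lim]) (auto simp: eventually_sequentially ev intro!: exI[of _ m0])
      moreover have "(\<lambda>m. h m ?z - P m ?z) \<longlonglongrightarrow> 0"
        by (rule Lim_null_comparison[OF _ LIMSEQ_inverse_real_of_nat])
          (auto simp: inverse_eq_divide intro!: always_eventually less_imp_le P(2) simp del: of_nat_Suc)
      ultimately show "(\<lambda>m. p m x) \<longlonglongrightarrow> G x"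
        unfolding p_def using tendsto_diff by fastforce
    qed
  qed
qed

section \<open>Exponentials cut to one period: orthogonality and completeness\<close>

lemma trig_mono_measurable [measurable]: "trig_mono L k \<in> borel_measurable borel"
  unfolding trig_mono_def by measurable

lemma trig_poly_measurable: "trig_poly L p \<Longrightarrow> p \<in> borel_measurable borel"
  by (induction rule: trig_poly.induct) simp_all

text \<open>The cut-off places the exponential in L2 of the line, so that \<open>l2_inner\<close>
  serves for Fourier series as well.\<close>

definition trig_loc :: "real \<Rightarrow> int \<Rightarrow> real \<Rightarrow> complex" where
  "trig_loc L k x = indicator {-L/2..L/2} x * trig_mono L k x"

lemma trig_loc_bdd_supp: "bdd_supp (trig_loc L k)"
  unfolding bdd_supp_def trig_loc_def
  by (intro conjI exI[of _ 1] exI[of _ "L / 2"], measurable)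
    (auto simp: indicator_def trig_mono_def)

lemma trig_loc_inner:
  assumes L: "0 < L"
  shows "l2_inner (trig_loc L k) (trig_loc L l) = (if k = l then of_real L else 0)"
proof -
  define a where "a = - (2 * pi * (real_of_int (k - l) / L))"
  have eq: "trig_loc L k x * cnj (trig_loc L l x) = indicator {-L/2..L/2} x *\<^sub>R cis (a * x)" for x
    by (auto simp: indicator_def trig_loc_def trig_mono_def cis_cnj cis_mult a_def algebra_simps diff_divide_distrib)
  show ?thesis
  proof (cases "k = l")
    case True
    then have "a = 0" by (simp add: a_def)
    then have "l2_inner (trig_loc L k) (trig_loc L l) = (LINT x|lborel. indicator {-L/2..L/2} x *\<^sub>R 1)"
      unfolding l2_inner_def eq by simp
    also have "\<dots> = of_real L" using L by (simp add: scaleR_conv_of_real)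
    finally show ?thesis using True by simp
  next
    case False
    then have a: "a \<noteq> 0" using L by (simp add: a_def)
    have "l2_inner (trig_loc L k) (trig_loc L l) = (LINT x|lborel. indicator {-L/2..L/2} x *\<^sub>R cis (a * x))"
      unfolding l2_inner_def eq ..
    also have "\<dots> = cis (a * (L/2)) / (\<i> * a) - cis (a * (-L/2)) / (\<i> * a)"
    proof (rule integral_FTC_Icc)
      fix x
      show "((\<lambda>x. cis (a * x) / (\<i> * a)) has_vector_derivative cis (a * x)) (at x within {-L/2..L/2})"
        unfolding cis_conv_exp using a
        by (auto intro!: derivative_eq_intros has_vector_derivative_real_field simp: mult_ac)
    qed (use L in \<open>auto intro!: continuous_intros\<close>)
    \<comment> \<open>The interval has length \<open>L\<close> and \<open>a * L\<close> is an
      integer multiple of \<open>2 * pi\<close>, so the antiderivative agrees at both ends.\<close>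
    also have "\<dots> = 0"
    proof -
      have "cis (a * (L/2)) = cis (a * (-L/2)) * cis (a * L)"
        by (simp add: cis_mult field_simps)
      moreover have "a * L = 2 * pi * real_of_int (l - k)" using L by (simp add: a_def field_simps)
      ultimately show ?thesis
        by (metis Ints_of_int cis_multiple_2pi diff_self mult.right_neutral)
    qed
    finally show ?thesis using False by simp
  qed
qed

text \<open>Completes the square in every coefficient. One identity serves two purposes:
  \<open>a k\<close> equal to the inner product over \<open>L\<close> gives Bessel's inequality, and
  arbitrary \<open>a k\<close> show that no other choice comes closer to \<open>G\<close>.\<close>

lemma orthogonal_expansion_norm:
  assumes E: "\<And>k. sq_int (E k)" "\<And>k l. l2_inner (E k) (E l) = (if k = l then complex_of_real L else 0)"
    and L: "0 < L" and G: "sq_int G" and K: "finite K"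
  shows "(l2_norm (\<lambda>x. G x - (\<Sum>k\<in>K. a k * E k x)))\<^sup>2 =
    (l2_norm G)\<^sup>2 - (\<Sum>k\<in>K. (cmod (l2_inner G (E k)))\<^sup>2) / L
      + (\<Sum>k\<in>K. (cmod (l2_inner G (E k) - L * a k))\<^sup>2) / L"
proof -
  define p where "p = (\<lambda>x. \<Sum>k\<in>K. a k * E k x)"
  have aE: "sq_int (\<lambda>x. a k * E k x)" for k by (intro sq_int_cmult E)
  then have p: "sq_int p" unfolding p_def by (intro sq_int_sum)
  have Gp: "l2_inner G p = (\<Sum>k\<in>K. cnj (a k) * l2_inner G (E k))"
    unfolding p_def by (simp add: l2_inner_sum_right aE G l2_inner_cmult_right)
  have "l2_inner p p = (\<Sum>k\<in>K. \<Sum>l\<in>K. a k * cnj (a l) * l2_inner (E k) (E l))"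
    unfolding p_def
    by (simp add: l2_inner_sum_left l2_inner_sum_right aE sq_int_sum l2_inner_cmult_left
        l2_inner_cmult_right sum_distrib_left mult_ac E)
  also have "\<dots> = (\<Sum>k\<in>K. a k * cnj (a k) * L)"
    using K by (simp add: E if_distrib sum.delta' cong: if_cong)
  also have "\<dots> = complex_of_real (\<Sum>k\<in>K. (cmod (a k))\<^sup>2 * L)"
    by (simp only: complex_norm_square of_real_sum of_real_mult)
  finally have pp: "(l2_norm p)\<^sup>2 = (\<Sum>k\<in>K. (cmod (a k))\<^sup>2 * L)"
    unfolding l2_inner_self of_real_eq_iff .
  have "(l2_norm (\<lambda>x. G x - p x))\<^sup>2
      = (l2_norm G)\<^sup>2 + (\<Sum>k\<in>K. (cmod (a k))\<^sup>2 * L - 2 * Re (cnj (a k) * l2_inner G (E k)))"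
    by (simp add: l2_norm_sq_diff G p pp Gp sum_subtractf sum_distrib_left)
  also have "(\<Sum>k\<in>K. (cmod (a k))\<^sup>2 * L - 2 * Re (cnj (a k) * l2_inner G (E k)))
     = (\<Sum>k\<in>K. (cmod (l2_inner G (E k) - L * a k))\<^sup>2 / L - (cmod (l2_inner G (E k)))\<^sup>2 / L)"
  proof (rule sum.cong)
    fix k
    show "(cmod (a k))\<^sup>2 * L - 2 * Re (cnj (a k) * l2_inner G (E k))
      = (cmod (l2_inner G (E k) - L * a k))\<^sup>2 / L - (cmod (l2_inner G (E k)))\<^sup>2 / L"
      using L unfolding cmod_power2 by (simp add: field_simps power2_eq_square)
  qed simp
  finally show ?thesis
    by (simp add: p_def sum_subtractf sum_divide_distrib)
qed

definition supp_in :: "real \<Rightarrow> (real \<Rightarrow> complex) \<Rightarrow> bool" where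
  "supp_in R g \<longleftrightarrow> (\<forall>x. R < \<bar>x\<bar> \<longrightarrow> g x = 0)"

text \<open>Uniformly bounded a.e. convergence on the period becomes L2 convergence by dominated
  convergence; the two endpoints form a null set.\<close>

lemma trig_poly_l2_approx:
  assumes G: "bdd_supp G" and L: "0 < L" and supp: "supp_in (L / 2) G" and e: "0 < e"
  obtains K a where "finite K" "(l2_norm (\<lambda>x. G x - (\<Sum>k\<in>K. a k * trig_loc L k x)))\<^sup>2 < e"
proof -
  obtain p C where p: "\<And>m. trig_poly L (p m)" and C: "\<And>m x. cmod (p m x) \<le> C"
    and lim: "AE x in lborel. x \<in> {-L/2<..<L/2} \<longrightarrow> (\<lambda>m. p m x) \<longlonglongrightarrow> G x"
    by (rule trig_poly_ae_approx[OF G L]) (rule that)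
  obtain D where D: "0 < D" "\<And>x. cmod (G x) \<le> D" using bdd_supp_bounded[OF G] by metis
  let ?I = "{-L/2..L/2}"
  have [measurable]: "p m \<in> borel_measurable borel" for m
    using p[of m] by (rule trig_poly_measurable)
  note [measurable] = bdd_supp_measurable[OF G]
  have G0: "G x = 0" if "x \<notin> ?I" for x
  proof -
    from that have "L / 2 < \<bar>x\<bar>" by auto
    then show ?thesis using supp by (simp add: supp_in_def)
  qed
  have "(\<lambda>m. LINT x|lborel. (cmod (G x - indicator ?I x * p m x))\<^sup>2) \<longlonglongrightarrow> (LINT x|(lborel :: real measure). 0)"
  proof (rule integral_dominated_convergence[where w = "\<lambda>x. (D + C)\<^sup>2 * indicator ?I x"])
    show "integrable lborel (\<lambda>x. (D + C)\<^sup>2 * indicator ?I x)"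
      by (intro integrable_mult_right integrable_real_indicator) (auto simp: emeasure_lborel_Icc_eq)
    have "AE x in lborel. x \<noteq> L / 2" "AE x in lborel. x \<noteq> - L / 2"
      by (rule AE_lborel_singleton)+
    with lim show "AE x in lborel. (\<lambda>m. (cmod (G x - indicator ?I x * p m x))\<^sup>2) \<longlonglongrightarrow> 0"
    proof eventually_elim
      case (elim x)
      show ?case
      proof (cases "x \<in> ?I")
        case True
        then have "(\<lambda>m. p m x) \<longlonglongrightarrow> G x" using elim by auto
        then have "(\<lambda>m. (cmod (G x - p m x))\<^sup>2) \<longlonglongrightarrow> (cmod (G x - G x))\<^sup>2" by (intro tendsto_intros)
        then show ?thesis using True by simp
      next
        case False
        then show ?thesis using G0[OF False] by simp
      qed
    qed
    show "AE x in lborel. norm ((cmod (G x - indicator ?I x * p m x))\<^sup>2) \<le> (D + C)\<^sup>2 * indicator ?I x" for m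
    proof (rule AE_I2)
      fix x
      show "norm ((cmod (G x - indicator ?I x * p m x))\<^sup>2) \<le> (D + C)\<^sup>2 * indicator ?I x"
      proof (cases "x \<in> ?I")
        case True
        have "cmod (G x - p m x) \<le> D + C"
          by (intro order_trans[OF norm_triangle_ineq4] add_mono C D)
        then show ?thesis using True by (simp add: power_mono)
      next
        case False
        then show ?thesis using G0[OF False] by simp
      qed
    qed
  qed measurable
  then have "\<forall>\<^sub>F m in sequentially. (LINT x|lborel. (cmod (G x - indicator ?I x * p m x))\<^sup>2) < e"
    using e by (intro order_tendstoD) auto
  then obtain m where m: "(LINT x|lborel. (cmod (G x - indicator ?I x * p m x))\<^sup>2) < e"
    by (auto simp: eventually_sequentially)
  obtain K a where K: "finite K" "\<And>x. p m x = (\<Sum>k\<in>K. a k * trig_mono L k x)"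
    by (rule trig_poly_expansion[OF p]) (rule that)
  have "indicator ?I x * p m x = (\<Sum>k\<in>K. a k * trig_loc L k x)" for x
    unfolding K trig_loc_def sum_distrib_left by (simp add: mult.left_commute)
  with m K show ?thesis by (intro that[of K a]) (simp_all add: l2_norm_sq)
qed

text \<open>Under the support condition the cut-off is invisible, so Fourier coefficients are
  samples of the inverse transform at spacing \<open>1 / L\<close>.\<close>

lemma trig_loc_coeff:
  assumes "supp_in (L / 2) G"
  shows "l2_inner G (trig_loc L k) = inv_fourier G (real_of_int k / L)"
proof -
  have "G x * cnj (trig_loc L k x) = G x * cis (2 * pi * (real_of_int k / L) * x)" for x
  proof (cases "G x = 0")
    case False
    then have "\<bar>x\<bar> \<le> L / 2" using assms by (meson not_le supp_in_def)
    then have "x \<in> {-L/2..L/2}" by auto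
    then show ?thesis by (simp add: trig_loc_def trig_mono_def cis_cnj)
  qed simp
  then show ?thesis unfolding l2_inner_def inv_fourier_def by (simp only:)
qed

theorem fourier_series_parseval:
  assumes G: "bdd_supp G" and L: "0 < L" and supp: "supp_in (L / 2) G"
  shows "((\<lambda>k. (cmod (inv_fourier G (real_of_int k / L)))\<^sup>2) has_sum (L * (l2_norm G)\<^sup>2)) UNIV"
  unfolding trig_loc_coeff[OF supp, symmetric]
proof (rule has_sum_nonneg_realI)
  note ident = orthogonal_expansion_norm[OF bdd_supp_sq_int[OF trig_loc_bdd_supp] trig_loc_inner[OF L] L
      bdd_supp_sq_int[OF G]]
  fix K :: "int set" assume K: "finite K"
  \<comment> \<open>These coefficients annihilate the last sum of the identity, which leaves
    Bessel's inequality.\<close>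
  have "0 \<le> (l2_norm (\<lambda>x. G x - (\<Sum>k\<in>K. l2_inner G (trig_loc L k) / L * trig_loc L k x)))\<^sup>2"
    by simp
  also have "\<dots> = (l2_norm G)\<^sup>2 - (\<Sum>k\<in>K. (cmod (l2_inner G (trig_loc L k)))\<^sup>2) / L"
    unfolding ident[OF K] using L by simp
  finally have "0 \<le> (l2_norm G)\<^sup>2 - (\<Sum>k\<in>K. (cmod (l2_inner G (trig_loc L k)))\<^sup>2) / L" .
  then show "(\<Sum>k\<in>K. (cmod (l2_inner G (trig_loc L k)))\<^sup>2) \<le> L * (l2_norm G)\<^sup>2"
    using L by (simp add: field_simps)
next
  note ident = orthogonal_expansion_norm[OF bdd_supp_sq_int[OF trig_loc_bdd_supp] trig_loc_inner[OF L] L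
      bdd_supp_sq_int[OF G]]
  fix e :: real assume e: "0 < e"
  obtain K a where K: "finite K" "(l2_norm (\<lambda>x. G x - (\<Sum>k\<in>K. a k * trig_loc L k x)))\<^sup>2 < e / L"
    by (rule trig_poly_l2_approx[OF G L supp, of "e / L"]) (use e L in simp, rule that)
  \<comment> \<open>The approximant has arbitrary coefficients, but replacing them by the Fourier
    coefficients drops a nonnegative sum and only shrinks the error.\<close>
  have "(l2_norm G)\<^sup>2 - (\<Sum>k\<in>K. (cmod (l2_inner G (trig_loc L k)))\<^sup>2) / L < e / L"
  proof -
    have "0 \<le> (\<Sum>k\<in>K. (cmod (l2_inner G (trig_loc L k) - L * a k))\<^sup>2) / L"
      using L by (intro divide_nonneg_pos sum_nonneg) auto
    then show ?thesis using K(2) unfolding ident[OF K(1)] by linarith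
  qed
  then have "L * ((l2_norm G)\<^sup>2 - (\<Sum>k\<in>K. (cmod (l2_inner G (trig_loc L k)))\<^sup>2) / L) < L * (e / L)"
    using L by (rule mult_strict_left_mono)
  then have "L * (l2_norm G)\<^sup>2 - e < (\<Sum>k\<in>K. (cmod (l2_inner G (trig_loc L k)))\<^sup>2)"
    using L by (simp add: right_diff_distrib)
  then show "\<exists>K. finite K \<and> L * (l2_norm G)\<^sup>2 - e < (\<Sum>k\<in>K. (cmod (l2_inner G (trig_loc L k)))\<^sup>2)"
    using K(1) by blast
qed simp

section \<open>Plancherel for bounded functions of compact support\<close>

lemma supp_in_add: "supp_in R f \<Longrightarrow> supp_in R g \<Longrightarrow> supp_in R (\<lambda>x. f x + g x)"
  and supp_in_cmult: "supp_in R f \<Longrightarrow> supp_in R (\<lambda>x. a * f x)"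
  and supp_in_mult_right: "supp_in R f \<Longrightarrow> supp_in R (\<lambda>x. f x * h x)"
  by (auto simp: supp_in_def)

lemma inv_fourier_integrable:
  "bdd_supp g \<Longrightarrow> integrable lborel (\<lambda>y. g y * cis (2 * pi * x * y))"
  by (intro bdd_supp_integrable bdd_supp_modulate)

lemma inv_fourier_add:
  "bdd_supp f \<Longrightarrow> bdd_supp g \<Longrightarrow> inv_fourier (\<lambda>x. f x + g x) = (\<lambda>x. inv_fourier f x + inv_fourier g x)"
  unfolding inv_fourier_def by (simp add: distrib_right inv_fourier_integrable)

lemma inv_fourier_diff:
  "bdd_supp f \<Longrightarrow> bdd_supp g \<Longrightarrow> inv_fourier (\<lambda>x. f x - g x) = (\<lambda>x. inv_fourier f x - inv_fourier g x)"
  unfolding inv_fourier_def by (simp add: left_diff_distrib inv_fourier_integrable)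

lemma inv_fourier_cmult: "inv_fourier (\<lambda>x. a * g x) = (\<lambda>x. a * inv_fourier g x)"
  unfolding inv_fourier_def by (simp add: mult.assoc)

lemma inv_fourier_zero: "inv_fourier (\<lambda>x. 0) = (\<lambda>x. 0)"
  unfolding inv_fourier_def by simp

lemma inv_fourier_sum:
  "(\<And>i. i \<in> F \<Longrightarrow> bdd_supp (g i)) \<Longrightarrow>
    inv_fourier (\<lambda>x. \<Sum>i\<in>F. g i x) = (\<lambda>x. \<Sum>i\<in>F. inv_fourier (g i) x)"
  by (induction F rule: infinite_finite_induct) (simp_all add: inv_fourier_zero inv_fourier_add bdd_supp_sum)

lemma inv_fourier_modulate:
  "inv_fourier (\<lambda>y. g y * cis (2 * pi * a * y)) x = inv_fourier g (a + x)"
  unfolding inv_fourier_def by (simp add: mult.assoc cis_mult distrib_left distrib_right)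

lemma inv_fourier_measurable [measurable]:
  assumes [measurable]: "g \<in> borel_measurable borel"
  shows "inv_fourier g \<in> borel_measurable borel"
  unfolding inv_fourier_def by measurable

lemma inv_fourier_norm_le: "cmod (inv_fourier g x) \<le> (LINT y|lborel. cmod (g y))"
  unfolding inv_fourier_def
  using integral_norm_bound[of lborel "\<lambda>y. g y * cis (2 * pi * x * y)"] by (simp add: norm_mult)

text \<open>Polarizes \<open>fourier_series_parseval\<close>, applied to \<open>G + a U\<close> with
  \<open>a\<close> running through the four fourth roots of unity.\<close>

theorem fourier_series_inner:
  assumes G: "bdd_supp G" "supp_in (L / 2) G" and U: "bdd_supp U" "supp_in (L / 2) U" and L: "0 < L"
  shows "((\<lambda>k. inv_fourier G (real_of_int k / L) * cnj (inv_fourier U (real_of_int k / L)))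
    has_sum (L * l2_inner G U)) UNIV"
proof -
  have P: "((\<lambda>k. complex_of_real ((cmod (inv_fourier G (real_of_int k / L) + a * inv_fourier U (real_of_int k / L)))\<^sup>2))
      has_sum complex_of_real (L * (l2_norm (\<lambda>x. G x + a * U x))\<^sup>2)) UNIV" for a
    using fourier_series_parseval[of "\<lambda>x. G x + a * U x" L] G U L
    unfolding has_sum_of_real_iff
    by (simp add: bdd_supp_add bdd_supp_cmult supp_in_add supp_in_cmult inv_fourier_add inv_fourier_cmult)
  have "((\<lambda>k. 1/4 * complex_of_real ((cmod (inv_fourier G (real_of_int k / L) + 1 * inv_fourier U (real_of_int k / L)))\<^sup>2)
      + (-1/4) * complex_of_real ((cmod (inv_fourier G (real_of_int k / L) + (-1) * inv_fourier U (real_of_int k / L)))\<^sup>2)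
      + (\<i>/4) * complex_of_real ((cmod (inv_fourier G (real_of_int k / L) + \<i> * inv_fourier U (real_of_int k / L)))\<^sup>2)
      + (-\<i>/4) * complex_of_real ((cmod (inv_fourier G (real_of_int k / L) + (-\<i>) * inv_fourier U (real_of_int k / L)))\<^sup>2))
      has_sum
      (1/4 * complex_of_real (L * (l2_norm (\<lambda>x. G x + 1 * U x))\<^sup>2)
      + (-1/4) * complex_of_real (L * (l2_norm (\<lambda>x. G x + (-1) * U x))\<^sup>2)
      + (\<i>/4) * complex_of_real (L * (l2_norm (\<lambda>x. G x + \<i> * U x))\<^sup>2)
      + (-\<i>/4) * complex_of_real (L * (l2_norm (\<lambda>x. G x + (-\<i>) * U x))\<^sup>2))) UNIV"
    by (intro has_sum_add has_sum_cmult_right P)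
  then show ?thesis
    unfolding polarization l2_inner_polarization[OF bdd_supp_sq_int[OF G(1)] bdd_supp_sq_int[OF U(1)]]
    by (simp add: diff_divide_distrib add_divide_distrib right_diff_distrib distrib_left mult.left_commute)
qed

lemma bdd_supp_supp_in:
  assumes "bdd_supp g" obtains R where "0 < R" "supp_in R g"
proof -
  obtain M R where R: "0 < R" "\<And>x. cmod (g x) \<le> M * indicator {-R..R} x"
    using bdd_suppE[OF assms] by metis
  have "g x = 0" if "R < \<bar>x\<bar>" for x
  proof -
    from that have "x \<notin> {-R..R}" by auto
    with R(2)[of x] show ?thesis by simp
  qed
  then show ?thesis using R(1) by (intro that[of R]) (auto simp: supp_in_def)
qed

lemma l2_norm_modulate: "l2_norm (\<lambda>x. g x * cis (a * x)) = l2_norm g"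
  by (simp add: l2_norm_def norm_mult)

text \<open>Parseval for the Fourier series of all modulations of \<^term>\<open>G\<close> evaluates the sum of
  \<^term>\<open>(cmod (inv_fourier G y))\<^sup>2\<close> over every coset of \<open>(1 / L)\<int>\<close>; integrating over a
  fundamental domain gives Plancherel.\<close>

lemma plancherel_nn_integral:
  assumes G: "bdd_supp G"
  shows "(\<integral>\<^sup>+x. ennreal ((cmod (inv_fourier G x))\<^sup>2) \<partial>lborel) = ennreal ((l2_norm G)\<^sup>2)"
proof -
  obtain R where R: "0 < R" "supp_in R G" using bdd_supp_supp_in[OF G] by metis
  define L where "L = 2 * R"
  have L: "0 < L" "supp_in (L / 2) G" using R by (auto simp: L_def)
  note [measurable] = bdd_supp_measurable[OF G]
  define F where "F = (\<lambda>x. (cmod (inv_fourier G x))\<^sup>2)"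
  have [measurable]: "F \<in> borel_measurable borel" unfolding F_def by measurable
  \<comment> \<open>Cells of length \<open>1 / L\<close> tiling the line. Enumerating them by
    naturals through \<open>int_decode\<close> makes countable additivity available as
    \<open>suminf\<close>.\<close>
  define A where "A = (\<lambda>n. {real_of_int (int_decode n) / L..<(real_of_int (int_decode n) + 1) / L})"
  have sumF: "(\<Sum>n. ennreal (F (real_of_int (int_decode n) / L + x))) = ennreal (L * (l2_norm G)\<^sup>2)" for x
  proof -
    have "((\<lambda>k. (cmod (inv_fourier (\<lambda>y. G y * cis (2 * pi * x * y)) (real_of_int k / L)))\<^sup>2)
        has_sum (L * (l2_norm (\<lambda>y. G y * cis (2 * pi * x * y)))\<^sup>2)) UNIV"
      using L by (intro fourier_series_parseval bdd_supp_modulate G supp_in_mult_right)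
    then have "((\<lambda>k. F (real_of_int k / L + x)) has_sum (L * (l2_norm G)\<^sup>2)) UNIV"
      unfolding l2_norm_modulate inv_fourier_modulate F_def by (simp add: add.commute)
    then have "((\<lambda>n. F (real_of_int (int_decode n) / L + x)) has_sum (L * (l2_norm G)\<^sup>2)) UNIV"
      using has_sum_reindex_bij_betw[OF bij_int_decode, of "\<lambda>k. F (real_of_int k / L + x)"] by simp
    from has_sum_imp_sums[OF this] show ?thesis
      by (subst suminf_ennreal2) (auto simp: sums_iff F_def)
  qed
  have single: "(\<Sum>n. ennreal (F x) * indicator (A n) x) = ennreal (F x)" for x
  proof -
    define m where "m = int_encode \<lfloor>x * L\<rfloor>"
    have iff: "x \<in> A n \<longleftrightarrow> n = m" for n
    proof -
      have "x \<in> A n \<longleftrightarrow> real_of_int (int_decode n) \<le> x * L \<and> x * L < real_of_int (int_decode n) + 1"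
        using L(1) by (simp add: A_def field_simps)
      also have "\<dots> \<longleftrightarrow> \<lfloor>x * L\<rfloor> = int_decode n" by (rule floor_eq_iff[symmetric])
      also have "\<dots> \<longleftrightarrow> n = m"
        unfolding m_def by (metis int_decode_inverse int_encode_inverse)
      finally show ?thesis .
    qed
    have "(\<Sum>n. ennreal (F x) * indicator (A n) x) = (\<Sum>n\<in>{m}. ennreal (F x) * indicator (A n) x)"
      by (rule suminf_finite) (auto simp: iff)
    then show ?thesis using iff[of m] by simp
  qed
  have [measurable]: "A n \<in> sets borel" for n by (simp add: A_def)
  have "(\<integral>\<^sup>+x. ennreal (F x) \<partial>lborel) = (\<integral>\<^sup>+x. (\<Sum>n. ennreal (F x) * indicator (A n) x) \<partial>lborel)"
    unfolding single ..
  also have "\<dots> = (\<Sum>n. \<integral>\<^sup>+x. ennreal (F x) * indicator (A n) x \<partial>lborel)"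
    by (rule nn_integral_suminf) measurable
  also have "\<dots> = (\<Sum>n. \<integral>\<^sup>+x. ennreal (F (real_of_int (int_decode n) / L + x)) * indicator {0..<1/L} x \<partial>lborel)"
  proof (rule arg_cong[where f = suminf], rule ext)
    fix n
    have "real_of_int (int_decode n) / L + x \<in> A n \<longleftrightarrow> x \<in> {0..<1/L}" for x
      by (auto simp: A_def add_divide_distrib)
    then have "indicator (A n) (real_of_int (int_decode n) / L + x) = (indicator {0..<1/L} x :: ennreal)" for x
      by (simp add: indicator_def)
    then show "(\<integral>\<^sup>+x. ennreal (F x) * indicator (A n) x \<partial>lborel)
      = (\<integral>\<^sup>+x. ennreal (F (real_of_int (int_decode n) / L + x)) * indicator {0..<1/L} x \<partial>lborel)"
      by (subst nn_integral_real_affine[where c = 1 and t = "real_of_int (int_decode n) / L"]) simp_all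
  qed
  also have "\<dots> = (\<integral>\<^sup>+x. (\<Sum>n. ennreal (F (real_of_int (int_decode n) / L + x)) * indicator {0..<1/L} x) \<partial>lborel)"
    by (rule nn_integral_suminf[symmetric]) measurable
  also have "\<dots> = (\<integral>\<^sup>+x. ennreal (L * (l2_norm G)\<^sup>2) * indicator {0..<1/L} x \<partial>lborel)"
    by (simp add: sumF)
  also have "\<dots> = ennreal (L * (l2_norm G)\<^sup>2) * ennreal (1 / L)"
    using L(1) by (simp add: nn_integral_cmult_indicator)
  also have "\<dots> = ennreal ((l2_norm G)\<^sup>2)"
    using L(1) by (simp flip: ennreal_mult)
  finally show ?thesis by (simp add: F_def)
qed

lemma plancherel_has_integral:
  assumes "bdd_supp G"
  shows "has_bochner_integral lborel (\<lambda>x. (cmod (inv_fourier G x))\<^sup>2) ((l2_norm G)\<^sup>2)"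
proof -
  note [measurable] = bdd_supp_measurable[OF assms]
  show ?thesis
    by (rule has_bochner_integral_nn_integral) (auto simp: plancherel_nn_integral[OF assms])
qed

lemma sq_int_inv_fourier:
  assumes "bdd_supp G" shows "sq_int (inv_fourier G)"
  using plancherel_has_integral[OF assms] inv_fourier_measurable[OF bdd_supp_measurable[OF assms]]
  by (auto simp: sq_int_def has_bochner_integral_iff)

theorem plancherel_norm:
  assumes "bdd_supp G" shows "l2_norm (inv_fourier G) = l2_norm G"
proof -
  have "(l2_norm (inv_fourier G))\<^sup>2 = (l2_norm G)\<^sup>2"
    using plancherel_has_integral[OF assms] by (simp add: l2_norm_sq has_bochner_integral_iff)
  then show ?thesis by simp
qed

theorem plancherel_inner:
  assumes "bdd_supp G" "bdd_supp U" shows "l2_inner (inv_fourier G) (inv_fourier U) = l2_inner G U"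
proof -
  have "l2_norm (\<lambda>x. inv_fourier G x + a * inv_fourier U x) = l2_norm (\<lambda>x. G x + a * U x)" for a
    using plancherel_norm[of "\<lambda>x. G x + a * U x"] assms
    by (simp add: inv_fourier_add inv_fourier_cmult bdd_supp_add bdd_supp_cmult)
  from this[of 1] this[of "-1"] this[of "\<i>"] this[of "-\<i>"] show ?thesis
    by (simp add: l2_inner_polarization sq_int_inv_fourier bdd_supp_sq_int assms)
qed

text \<open>Formally the adjoint of \<open>inv_fourier\<close> is the Fourier transform, that is,
  \<open>inv_fourier\<close> followed by a reflection. Fubini applies because the kernel has modulus
  1 and both functions are integrable.\<close>

lemma inv_fourier_multiplication:
  assumes f: "bdd_supp f" and g: "bdd_supp g"
  shows "l2_inner f (inv_fourier g) = l2_inner (\<lambda>y. inv_fourier f (- y)) g"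
proof -
  note [measurable] = assms[THEN bdd_supp_measurable]
  let ?k = "\<lambda>x y. f x * cnj (g y) * cis (- (2 * pi * x * y))"
  have int: "integrable (lborel \<Otimes>\<^sub>M lborel) (case_prod ?k)"
  proof (rule lborel_pair.Fubini_integrable)
    show "integrable lborel (\<lambda>x. LINT y|lborel. norm (case_prod ?k (x, y)))"
      using integrable_norm[OF bdd_supp_integrable[OF f]] by (simp add: norm_mult)
    show "AE x in lborel. integrable lborel (\<lambda>y. case_prod ?k (x, y))"
    proof (rule AE_I2)
      fix x
      have "bdd_supp (\<lambda>y. f x * (cnj (g y) * cis (- (2 * pi * x) * y)))"
        by (intro bdd_supp_cmult bdd_supp_modulate bdd_supp_cnj g)
      from bdd_supp_integrable[OF this]
      show "integrable lborel (\<lambda>y. case_prod ?k (x, y))" by (simp add: mult.assoc)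
    qed
  qed measurable
  have "l2_inner f (inv_fourier g) = (LINT x|lborel. LINT y|lborel. ?k x y)"
    unfolding l2_inner_def inv_fourier_def
    by (simp flip: Bochner_Integration.integral_cnj integral_mult_right_zero add: cis_cnj mult.assoc)
  also have "\<dots> = (LINT y|lborel. LINT x|lborel. ?k x y)"
    by (rule lborel_pair.Fubini_integral[OF int, symmetric])
  also have "\<dots> = l2_inner (\<lambda>y. inv_fourier f (- y)) g"
  proof -
    have "(LINT x|lborel. ?k x y) = inv_fourier f (- y) * cnj (g y)" for y
    proof -
      have "(LINT x|lborel. ?k x y) = (LINT x|lborel. f x * cis (2 * pi * (- y) * x) * cnj (g y))"
        by (rule Bochner_Integration.integral_cong) (simp_all add: mult_ac)
      then show ?thesis by (simp add: inv_fourier_def)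
    qed
    then show ?thesis by (simp add: l2_inner_def)
  qed
  finally show ?thesis .
qed

section \<open>Truncation and density\<close>

lemma l2_truncate:
  assumes f: "sq_int f" and [measurable]: "\<And>n. A n \<in> sets borel"
    and A: "\<And>x. \<forall>\<^sub>F n in sequentially. x \<in> A n"
  shows "(\<lambda>n. (l2_norm (\<lambda>x. f x - f x * indicator (A n) x))\<^sup>2) \<longlonglongrightarrow> 0"
    and "(\<lambda>n. (l2_norm (\<lambda>x. f x * indicator (A n) x))\<^sup>2) \<longlonglongrightarrow> (l2_norm f)\<^sup>2"
proof -
  note [measurable] = sq_int_measurable[OF f]
  have "(\<lambda>n. LINT x|lborel. (cmod (f x - f x * indicator (A n) x))\<^sup>2) \<longlonglongrightarrow> (LINT x|(lborel :: real measure). 0)"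
  proof (rule integral_dominated_convergence[where w = "\<lambda>x. (cmod (f x))\<^sup>2"])
    show "AE x in lborel. (\<lambda>n. (cmod (f x - f x * indicator (A n) x))\<^sup>2) \<longlonglongrightarrow> 0"
    proof (rule AE_I2, rule tendsto_eventually)
      fix x show "\<forall>\<^sub>F n in sequentially. (cmod (f x - f x * indicator (A n) x))\<^sup>2 = 0"
        using A[of x] by eventually_elim simp
    qed
    show "AE x in lborel. norm ((cmod (f x - f x * indicator (A n) x))\<^sup>2) \<le> (cmod (f x))\<^sup>2" for n
      by (rule AE_I2) (auto simp: indicator_def)
  qed (use sq_int_integrable[OF f] in measurable)
  then show "(\<lambda>n. (l2_norm (\<lambda>x. f x - f x * indicator (A n) x))\<^sup>2) \<longlonglongrightarrow> 0"
    by (simp add: l2_norm_sq)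
  have "(\<lambda>n. LINT x|lborel. (cmod (f x * indicator (A n) x))\<^sup>2) \<longlonglongrightarrow> (LINT x|lborel. (cmod (f x))\<^sup>2)"
  proof (rule integral_dominated_convergence[where w = "\<lambda>x. (cmod (f x))\<^sup>2"])
    show "AE x in lborel. (\<lambda>n. (cmod (f x * indicator (A n) x))\<^sup>2) \<longlonglongrightarrow> (cmod (f x))\<^sup>2"
    proof (rule AE_I2, rule tendsto_eventually)
      fix x show "\<forall>\<^sub>F n in sequentially. (cmod (f x * indicator (A n) x))\<^sup>2 = (cmod (f x))\<^sup>2"
        using A[of x] by eventually_elim simp
    qed
    show "AE x in lborel. norm ((cmod (f x * indicator (A n) x))\<^sup>2) \<le> (cmod (f x))\<^sup>2" for n
      by (rule AE_I2) (auto simp: indicator_def)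
  qed (use sq_int_integrable[OF f] in measurable)
  then show "(\<lambda>n. (l2_norm (\<lambda>x. f x * indicator (A n) x))\<^sup>2) \<longlonglongrightarrow> (l2_norm f)\<^sup>2"
    by (simp add: l2_norm_sq)
qed

lemma bdd_supp_indicator:
  assumes [measurable]: "f \<in> borel_measurable borel" "A \<in> sets borel"
    and "\<And>x. x \<in> A \<Longrightarrow> cmod (f x) \<le> C" "A \<subseteq> {-R..R}"
  shows "bdd_supp (\<lambda>x. f x * indicator A x)"
proof -
  have "cmod (f x * indicator A x) \<le> \<bar>C\<bar> * indicator {-R..R} x" for x
    using assms(3)[of x] assms(4) by (auto simp: indicator_def)
  then show ?thesis unfolding bdd_supp_def by (intro conjI) (measurable, blast)
qed

lemma bdd_supp_dense:
  assumes f: "sq_int f" and e: "0 < e"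
  obtains g where "bdd_supp g" "(l2_norm (\<lambda>x. f x - g x))\<^sup>2 < e"
proof -
  note [measurable] = sq_int_measurable[OF f]
  define A where "A = (\<lambda>n. {x. cmod (f x) \<le> real n} \<inter> {- real n..real n})"
  have [measurable]: "A n \<in> sets borel" for n unfolding A_def by measurable
  have A: "\<forall>\<^sub>F n in sequentially. x \<in> A n" for x
  proof -
    obtain N where N: "max (cmod (f x)) \<bar>x\<bar> \<le> real N" using real_arch_simple by blast
    have "x \<in> A n" if "N \<le> n" for n
    proof -
      have "real N \<le> real n" using that by simp
      with N show ?thesis by (auto simp: A_def)
    qed
    then show ?thesis by (auto simp: eventually_sequentially)
  qed
  have "\<forall>\<^sub>F n in sequentially. (l2_norm (\<lambda>x. f x - f x * indicator (A n) x))\<^sup>2 < e"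
    using l2_truncate(1)[OF f _ A] e by (intro order_tendstoD) auto
  then obtain n where n: "(l2_norm (\<lambda>x. f x - f x * indicator (A n) x))\<^sup>2 < e"
    by (auto simp: eventually_sequentially)
  have "bdd_supp (\<lambda>x. f x * indicator (A n) x)"
    by (rule bdd_supp_indicator[where C = "real n" and R = "real n"]) (auto simp: A_def)
  with n show ?thesis by (rule that[rotated])
qed

text \<open>The approximants of \<open>h\<close> are inverse transforms of its Fourier transform
  \<open>H\<close>, cut to growing intervals. Their error is computed exactly as
  \<open>(l2_norm h)^2 - (l2_norm (g n))^2\<close>, which tends to 0 because Plancherel gives
  \<open>H\<close> and \<open>h\<close> the same norm.\<close>

theorem inv_fourier_dense:
  assumes f: "sq_int f" and e: "0 < e"
  obtains g where "bdd_supp g" "l2_norm (\<lambda>x. f x - inv_fourier g x) < e"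
proof -
  obtain h where h: "bdd_supp h" and fh: "(l2_norm (\<lambda>x. f x - h x))\<^sup>2 < (e / 2)\<^sup>2"
    using e by (auto intro: bdd_supp_dense[OF f, of "(e / 2)\<^sup>2"])
  note [measurable] = bdd_supp_measurable[OF h]
  \<comment> \<open>The Fourier transform of \<open>h\<close>: bounded, but in general without
    compact support, hence the truncations \<open>g n\<close>.\<close>
  define H where "H = (\<lambda>y. inv_fourier h (- y))"
  have Hm [measurable]: "H \<in> borel_measurable borel" unfolding H_def by measurable
  have norm_H: "(l2_norm H)\<^sup>2 = (l2_norm h)\<^sup>2"
    using lborel_integral_real_affine[of "- 1" "\<lambda>x. (cmod (inv_fourier h x))\<^sup>2" 0]
    unfolding plancherel_norm[OF h, symmetric] by (simp add: l2_norm_sq H_def)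
  have sqH: "sq_int H"
    using sq_int_integrable[OF sq_int_inv_fourier[OF h]] Hm
      lborel_integrable_real_affine_iff[of "- 1" "\<lambda>x. (cmod (inv_fourier h x))\<^sup>2" 0]
    by (simp add: sq_int_def H_def)
  define B where "B = (\<lambda>n. {- real n..real n})"
  define g where "g = (\<lambda>n x. H x * indicator (B n) x)"
  have g: "bdd_supp (g n)" for n
    unfolding g_def by (rule bdd_supp_indicator[where R = "real n"])
      (auto simp: B_def H_def intro: inv_fourier_norm_le)
  have "(l2_norm (\<lambda>x. h x - inv_fourier (g n) x))\<^sup>2 = (l2_norm h)\<^sup>2 - (l2_norm (g n))\<^sup>2" for n
  proof -
    \<comment> \<open>The cross term collapses to the squared norm of \<open>g n\<close>, which
      equals \<open>H\<close> on \<open>B n\<close> and 0 elsewhere.\<close>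
    have "l2_inner h (inv_fourier (g n)) = l2_inner H (g n)"
      unfolding H_def by (rule inv_fourier_multiplication[OF h g])
    also have "\<dots> = l2_inner (g n) (g n)"
      unfolding l2_inner_def g_def by (auto intro!: Bochner_Integration.integral_cong simp: indicator_def)
    finally have "Re (l2_inner h (inv_fourier (g n))) = (l2_norm (g n))\<^sup>2"
      by (simp add: l2_inner_self)
    then show ?thesis
      by (simp add: l2_norm_sq_diff bdd_supp_sq_int h sq_int_inv_fourier g plancherel_norm)
  qed
  moreover have "(\<lambda>n. (l2_norm h)\<^sup>2 - (l2_norm (g n))\<^sup>2) \<longlonglongrightarrow> (l2_norm h)\<^sup>2 - (l2_norm H)\<^sup>2"
    unfolding g_def
  proof (intro tendsto_diff tendsto_const l2_truncate(2)[OF sqH])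
    show "\<forall>\<^sub>F n in sequentially. x \<in> B n" for x
    proof -
      obtain N where N: "\<bar>x\<bar> \<le> real N" using real_arch_simple by blast
      have "x \<in> B n" if "N \<le> n" for n
      proof -
        have "real N \<le> real n" using that by simp
        with N show ?thesis by (auto simp: B_def)
      qed
      then show ?thesis by (auto simp: eventually_sequentially)
    qed
  qed (simp add: B_def)
  ultimately have lim: "(\<lambda>n. (l2_norm (\<lambda>x. h x - inv_fourier (g n) x))\<^sup>2) \<longlonglongrightarrow> 0"
    by (simp only: norm_H diff_self)
  have "\<forall>\<^sub>F n in sequentially. (l2_norm (\<lambda>x. h x - inv_fourier (g n) x))\<^sup>2 < (e / 2)\<^sup>2"
    by (rule order_tendstoD(2)[OF lim]) (use e in simp)
  then obtain n where n: "(l2_norm (\<lambda>x. h x - inv_fourier (g n) x))\<^sup>2 < (e / 2)\<^sup>2"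
    by (auto simp: eventually_sequentially)
  have "l2_norm (\<lambda>x. f x - inv_fourier (g n) x) = l2_norm (\<lambda>x. (f x - h x) + (h x - inv_fourier (g n) x))"
    by simp
  also have "\<dots> \<le> l2_norm (\<lambda>x. f x - h x) + l2_norm (\<lambda>x. h x - inv_fourier (g n) x)"
    by (intro l2_norm_triangle sq_int_diff f bdd_supp_sq_int h sq_int_inv_fourier g)
  also have "\<dots> < e / 2 + e / 2"
    using fh n e by (intro add_strict_mono power2_less_imp_less[OF _ less_imp_le[OF half_gt_zero]])
  finally show ?thesis using g by (intro that[of "g n"]) auto
qed

section \<open>Dual frames from a weak expansion on the frequency side\<close>

text \<open>Extends a Bessel bound from the dense class to all \<open>f\<close>. Plancherel carries
  \<open>inv_fourier g\<close> to the frequency side; the rest \<open>r\<close> is estimated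
  crudely, term by term, which is harmless because \<open>F\<close> stays fixed while
  \<open>r\<close> shrinks.\<close>

lemma l2_inner_inv_fourier_sum_le:
  assumes \<phi>: "\<And>i. bdd_supp (\<phi> i)" and B: "0 \<le> B"
    and bound: "\<And>g F. bdd_supp g \<Longrightarrow> finite F \<Longrightarrow> (\<Sum>i\<in>F. (cmod (l2_inner g (\<phi> i)))\<^sup>2) \<le> B * (l2_norm g)\<^sup>2"
    and f: "sq_int f" and F: "finite F"
  shows "(\<Sum>i\<in>F. (cmod (l2_inner f (inv_fourier (\<phi> i))))\<^sup>2) \<le> B * (l2_norm f)\<^sup>2"
proof -
  let ?\<psi> = "\<lambda>i. inv_fourier (\<phi> i)"
  have \<psi>: "sq_int (?\<psi> i)" for i by (intro sq_int_inv_fourier \<phi>)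
  define N where "N = (\<Sum>i\<in>F. l2_norm (?\<psi> i))"
  have N: "0 \<le> N" unfolding N_def by (intro sum_nonneg) simp
  have "L2_set (\<lambda>i. cmod (l2_inner f (?\<psi> i))) F \<le> sqrt B * l2_norm f + e" if "0 < e" for e
  proof -
    \<comment> \<open>The accumulated error is \<open>d * (sqrt B + N)\<close>, below
      \<open>e\<close>; the 1 keeps the denominator positive.\<close>
    define d where "d = e / (sqrt B + N + 1)"
    have d: "0 < d" using that B N by (simp add: d_def add_nonneg_pos)
    obtain g where g: "bdd_supp g" "l2_norm (\<lambda>x. f x - inv_fourier g x) < d"
      using inv_fourier_dense[OF f d] by metis
    define r where "r = (\<lambda>x. f x - inv_fourier g x)"
    have r: "sq_int r" unfolding r_def by (intro sq_int_diff f sq_int_inv_fourier g)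
    have rd: "l2_norm r \<le> d" using g(2) by (simp add: r_def)
    have split: "l2_inner f (?\<psi> i) = l2_inner g (\<phi> i) + l2_inner r (?\<psi> i)" for i
      by (simp add: r_def l2_inner_diff_left f sq_int_inv_fourier g \<phi> plancherel_inner)
    have "l2_norm g \<le> l2_norm f + d"
    proof -
      have "l2_norm g = l2_norm (\<lambda>x. f x + (- 1) * r x)" by (simp add: r_def plancherel_norm g)
      also have "\<dots> \<le> l2_norm f + l2_norm (\<lambda>x. (- 1) * r x)"
        by (intro l2_norm_triangle f sq_int_cmult r)
      also have "\<dots> = l2_norm f + l2_norm r" by (simp only: l2_norm_cmult) simp
      finally show ?thesis using rd by simp
    qed
    then have "sqrt B * l2_norm g \<le> sqrt B * (l2_norm f + d)" using B by (intro mult_left_mono) auto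
    have "L2_set (\<lambda>i. cmod (l2_inner f (?\<psi> i))) F
        \<le> L2_set (\<lambda>i. cmod (l2_inner g (\<phi> i)) + cmod (l2_inner r (?\<psi> i))) F"
      unfolding split by (intro L2_set_mono norm_triangle_ineq) simp
    also have "\<dots> \<le> L2_set (\<lambda>i. cmod (l2_inner g (\<phi> i))) F + L2_set (\<lambda>i. cmod (l2_inner r (?\<psi> i))) F"
      by (rule L2_set_triangle_ineq)
    also have "L2_set (\<lambda>i. cmod (l2_inner g (\<phi> i))) F \<le> sqrt (B * (l2_norm g)\<^sup>2)"
      unfolding L2_set_def using bound[OF g(1) F] by (rule real_sqrt_le_mono)
    also have "\<dots> = sqrt B * l2_norm g" by (simp add: real_sqrt_mult)
    also have "\<dots> \<le> sqrt B * (l2_norm f + d)" by fact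
    also have "L2_set (\<lambda>i. cmod (l2_inner r (?\<psi> i))) F \<le> (\<Sum>i\<in>F. cmod (l2_inner r (?\<psi> i)))"
      by (rule L2_set_le_sum) simp
    also have "\<dots> \<le> (\<Sum>i\<in>F. d * l2_norm (?\<psi> i))"
    proof (rule sum_mono)
      fix i
      have "cmod (l2_inner r (?\<psi> i)) \<le> l2_norm r * l2_norm (?\<psi> i)" by (intro l2_Cauchy_Schwarz r \<psi>)
      also have "\<dots> \<le> d * l2_norm (?\<psi> i)" by (intro mult_right_mono rd) simp
      finally show "cmod (l2_inner r (?\<psi> i)) \<le> d * l2_norm (?\<psi> i)" .
    qed
    also have "\<dots> = d * N" by (simp add: N_def sum_distrib_left)
    also have "sqrt B * (l2_norm f + d) + d * N \<le> sqrt B * l2_norm f + d * (sqrt B + N + 1)"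
      using d by (simp add: algebra_simps)
    also have "d * (sqrt B + N + 1) = e"
      using B N by (simp add: d_def add_nonneg_eq_0_iff)
    finally show ?thesis by simp
  qed
  then have "L2_set (\<lambda>i. cmod (l2_inner f (?\<psi> i))) F \<le> sqrt B * l2_norm f"
    by (rule field_le_epsilon)
  then have "(L2_set (\<lambda>i. cmod (l2_inner f (?\<psi> i))) F)\<^sup>2 \<le> (sqrt B * l2_norm f)\<^sup>2"
    by (intro power_mono) (auto simp: L2_set_nonneg)
  then show ?thesis
    using B by (simp add: L2_set_def power_mult_distrib sum_nonneg)
qed

lemma bessel_seqI:
  assumes \<psi>: "\<And>i. sq_int (\<psi> i)" and B: "0 < B"
    and bound: "\<And>f F. sq_int f \<Longrightarrow> finite F \<Longrightarrow> (\<Sum>i\<in>F. (cmod (l2_inner f (\<psi> i)))\<^sup>2) \<le> B * (l2_norm f)\<^sup>2"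
  shows "bessel_seq \<psi>"
  unfolding bessel_seq_def
proof (intro conjI allI exI[of _ B] impI)
  fix f assume f: "sq_int f"
  show summ: "(\<lambda>i. (cmod (l2_inner f (\<psi> i)))\<^sup>2) summable_on UNIV"
    using bound[OF f] by (intro nonneg_bdd_above_summable_on bdd_aboveI2[where M = "B * (l2_norm f)\<^sup>2"]) auto
  show "(\<Sum>\<^sub>\<infinity>i. (cmod (l2_inner f (\<psi> i)))\<^sup>2) \<le> B * (l2_norm f)\<^sup>2"
    using bound[OF f] by (intro infsum_le_finite_sums[OF summ]) auto
qed (use \<psi> B in auto)

lemma cmod_sum_mult_le_L2_set:
  fixes a b :: "'i \<Rightarrow> complex"
  shows "cmod (\<Sum>i\<in>F. a i * b i) \<le> L2_set (\<lambda>i. cmod (a i)) F * L2_set (\<lambda>i. cmod (b i)) F"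
proof -
  have "cmod (\<Sum>i\<in>F. a i * b i) \<le> (\<Sum>i\<in>F. \<bar>cmod (a i)\<bar> * \<bar>cmod (b i)\<bar>)"
    by (rule order_trans[OF norm_sum]) (simp add: norm_mult)
  also have "\<dots> \<le> L2_set (\<lambda>i. cmod (a i)) F * L2_set (\<lambda>i. cmod (b i)) F"
    by (rule L2_set_mult_ineq)
  finally show ?thesis .
qed

lemma L2_set_le_of_sum_le:
  "(\<Sum>i\<in>F. (a i)\<^sup>2) \<le> B * c\<^sup>2 \<Longrightarrow> 0 \<le> c \<Longrightarrow> L2_set a F \<le> sqrt B * c"
  unfolding L2_set_def by (drule real_sqrt_le_mono) (simp add: real_sqrt_mult)

text \<open>The adjoint form of a Bessel bound: the combination is paired with itself,
  Cauchy-Schwarz is applied to the coefficients, and one factor of its norm cancels.\<close>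

lemma synthesis_bound:
  assumes \<psi>: "\<And>i. sq_int (\<psi> i)" and B: "0 \<le> B"
    and bound: "\<And>f. sq_int f \<Longrightarrow> (\<Sum>i\<in>F. (cmod (l2_inner f (\<psi> i)))\<^sup>2) \<le> B * (l2_norm f)\<^sup>2"
  shows "l2_norm (\<lambda>x. \<Sum>i\<in>F. a i * \<psi> i x) \<le> sqrt B * L2_set (\<lambda>i. cmod (a i)) F"
proof -
  define u where "u = (\<lambda>x. \<Sum>i\<in>F. a i * \<psi> i x)"
  have a\<psi>: "sq_int (\<lambda>x. a i * \<psi> i x)" for i by (intro sq_int_cmult \<psi>)
  then have u: "sq_int u" unfolding u_def by (intro sq_int_sum)
  have "l2_inner u u = (\<Sum>i\<in>F. a i * l2_inner (\<psi> i) u)"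
    by (subst u_def, subst l2_inner_sum_left) (simp_all add: a\<psi> u l2_inner_cmult_left)
  then have "complex_of_real ((l2_norm u)\<^sup>2) = (\<Sum>i\<in>F. a i * l2_inner (\<psi> i) u)"
    by (simp add: l2_inner_self)
  then have "(l2_norm u)\<^sup>2 = cmod (\<Sum>i\<in>F. a i * l2_inner (\<psi> i) u)"
    by (metis abs_of_nonneg norm_of_real zero_le_power2)
  also have "\<dots> \<le> L2_set (\<lambda>i. cmod (a i)) F * L2_set (\<lambda>i. cmod (l2_inner (\<psi> i) u)) F"
    by (rule cmod_sum_mult_le_L2_set)
  also have "L2_set (\<lambda>i. cmod (l2_inner (\<psi> i) u)) F = L2_set (\<lambda>i. cmod (l2_inner u (\<psi> i))) F"
    by (subst l2_inner_commute) simp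
  also have "L2_set (\<lambda>i. cmod (a i)) F * L2_set (\<lambda>i. cmod (l2_inner u (\<psi> i))) F
      \<le> L2_set (\<lambda>i. cmod (a i)) F * (sqrt B * l2_norm u)"
    using bound[OF u] by (intro mult_left_mono L2_set_le_of_sum_le L2_set_nonneg) auto
  finally have "l2_norm u * l2_norm u \<le> (sqrt B * L2_set (\<lambda>i. cmod (a i)) F) * l2_norm u"
    by (simp add: power2_eq_square mult_ac)
  then have "l2_norm u \<le> sqrt B * L2_set (\<lambda>i. cmod (a i)) F"
    using B L2_set_nonneg[of "\<lambda>i. cmod (a i)" F] l2_norm_nonneg[of u]
    by (cases "l2_norm u = 0") (auto simp: mult_le_cancel_right)
  then show ?thesis by (simp add: u_def)
qed

text \<open>Pairing the remainder \<open>u = g - (\<Sum>i\<in>F. a i \<phi> i)\<close> with itself turns the weak expansion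
  into a norm estimate: \<open>\<parallel>u\<parallel>\<^sup>2\<close> is the tail of the weak series outside \<open>F\<close>, hence at most
  \<open>sqrt B \<parallel>u\<parallel>\<close> times the \<open>\<ell>\<^sup>2\<close> norm of the tail of \<open>a\<close>.\<close>

lemma weak_expansion_remainder:
  assumes \<phi>: "\<And>i. bdd_supp (\<phi> i)" and g: "bdd_supp g" and B: "0 \<le> B"
    and bound: "\<And>u K. bdd_supp u \<Longrightarrow> finite K \<Longrightarrow> (\<Sum>i\<in>K. (cmod (l2_inner u (\<phi> i)))\<^sup>2) \<le> B * (l2_norm u)\<^sup>2"
    and weak: "\<And>u. bdd_supp u \<Longrightarrow> ((\<lambda>i. a i * l2_inner (\<phi> i) u) has_sum l2_inner g u) UNIV"
    and F: "finite F" and t: "0 \<le> t"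
    and tail: "\<And>K. finite K \<Longrightarrow> K \<inter> F = {} \<Longrightarrow> L2_set (\<lambda>i. cmod (a i)) K \<le> t"
  shows "l2_norm (\<lambda>x. g x - (\<Sum>i\<in>F. a i * \<phi> i x)) \<le> t * sqrt B"
proof -
  define u where "u = (\<lambda>x. g x - (\<Sum>i\<in>F. a i * \<phi> i x))"
  have a\<phi>: "bdd_supp (\<lambda>x. a i * \<phi> i x)" for i by (intro bdd_supp_cmult \<phi>)
  have u: "bdd_supp u" unfolding u_def by (intro bdd_supp_diff g bdd_supp_sum a\<phi>)
  have uu: "l2_inner u u = l2_inner g u - (\<Sum>i\<in>F. a i * l2_inner (\<phi> i) u)"
    by (subst u_def, subst l2_inner_diff_left)
      (simp_all add: bdd_supp_sq_int g u bdd_supp_sum a\<phi> l2_inner_sum_left l2_inner_cmult_left)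
  have "(l2_norm u)\<^sup>2 \<le> t * (sqrt B * l2_norm u) + e" if e: "0 < e" for e
  proof -
    obtain X where X: "finite X" "\<And>K. finite K \<Longrightarrow> X \<subseteq> K \<Longrightarrow> dist (\<Sum>i\<in>K. a i * l2_inner (\<phi> i) u) (l2_inner g u) < e"
      using tendstoD[OF weak[OF u, unfolded has_sum_def] e] unfolding eventually_finite_subsets_at_top
      by auto
    \<comment> \<open>Containing \<open>X\<close> puts the partial sum near the weak limit;
      containing \<open>F\<close> makes \<open>K - F\<close> a piece of the tail.\<close>
    define K where "K = X \<union> F"
    have K: "finite K" using X F by (simp add: K_def)
    have near: "cmod (l2_inner g u - (\<Sum>i\<in>K. a i * l2_inner (\<phi> i) u)) < e"
      using X(2)[OF K] by (simp add: K_def dist_norm norm_minus_commute)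
    have "l2_inner u u = (l2_inner g u - (\<Sum>i\<in>K. a i * l2_inner (\<phi> i) u)) + (\<Sum>i\<in>K - F. a i * l2_inner (\<phi> i) u)"
      unfolding uu using K by (subst sum_diff) (auto simp: K_def)
    then have "complex_of_real ((l2_norm u)\<^sup>2)
      = (l2_inner g u - (\<Sum>i\<in>K. a i * l2_inner (\<phi> i) u)) + (\<Sum>i\<in>K - F. a i * l2_inner (\<phi> i) u)"
      by (simp only: l2_inner_self)
    then have "(l2_norm u)\<^sup>2
      = cmod ((l2_inner g u - (\<Sum>i\<in>K. a i * l2_inner (\<phi> i) u)) + (\<Sum>i\<in>K - F. a i * l2_inner (\<phi> i) u))"
      by (metis abs_of_nonneg norm_of_real zero_le_power2)
    also have "\<dots> \<le> e + cmod (\<Sum>i\<in>K - F. a i * l2_inner (\<phi> i) u)"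
      using near by (intro order_trans[OF norm_triangle_ineq] add_right_mono) simp
    also have "cmod (\<Sum>i\<in>K - F. a i * l2_inner (\<phi> i) u)
        \<le> L2_set (\<lambda>i. cmod (a i)) (K - F) * L2_set (\<lambda>i. cmod (l2_inner (\<phi> i) u)) (K - F)"
      by (rule cmod_sum_mult_le_L2_set)
    also have "L2_set (\<lambda>i. cmod (l2_inner (\<phi> i) u)) (K - F) = L2_set (\<lambda>i. cmod (l2_inner u (\<phi> i))) (K - F)"
      by (subst l2_inner_commute) simp
    also have "L2_set (\<lambda>i. cmod (a i)) (K - F) * \<dots> \<le> t * (sqrt B * l2_norm u)"
      using tail[of "K - F"] K t bound[OF u, of "K - F"]
      by (intro mult_mono L2_set_le_of_sum_le) (auto simp: L2_set_nonneg)
    finally show ?thesis by simp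
  qed
  then have "(l2_norm u)\<^sup>2 \<le> t * (sqrt B * l2_norm u)" by (rule field_le_epsilon)
  then have "l2_norm u \<le> t * sqrt B"
  proof (cases "l2_norm u = 0")
    case False
    then have "0 < l2_norm u" using l2_norm_nonneg[of u] by linarith
    then show ?thesis
      using \<open>(l2_norm u)\<^sup>2 \<le> t * (sqrt B * l2_norm u)\<close>
      by (simp add: power2_eq_square flip: mult.assoc)
  qed (use B t in simp)
  then show ?thesis by (simp add: u_def)
qed

text \<open>With \<open>f = inv_fourier g + r\<close>, the remainder for \<open>f\<close> is
  \<open>r\<close>, plus the inverse transform of the remainder \<open>u\<close> for
  \<open>g\<close>, minus the combination synthesised from the coefficients of \<open>r\<close>. The
  Bessel bounds control this last part uniformly in \<open>F\<close>, so \<open>F0\<close> can be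
  chosen for \<open>g\<close> alone.\<close>

lemma dual_frames_inv_fourierI:
  fixes \<phi> \<phi>' :: "'i \<Rightarrow> real \<Rightarrow> complex"
  assumes \<phi>: "\<And>i. bdd_supp (\<phi> i)" and \<phi>': "\<And>i. bdd_supp (\<phi>' i)" and B: "0 < B"
    and bound: "\<And>g F. bdd_supp g \<Longrightarrow> finite F \<Longrightarrow> (\<Sum>i\<in>F. (cmod (l2_inner g (\<phi> i)))\<^sup>2) \<le> B * (l2_norm g)\<^sup>2"
    and bound': "\<And>g F. bdd_supp g \<Longrightarrow> finite F \<Longrightarrow> (\<Sum>i\<in>F. (cmod (l2_inner g (\<phi>' i)))\<^sup>2) \<le> B * (l2_norm g)\<^sup>2"
    and weak: "\<And>g u. bdd_supp g \<Longrightarrow> bdd_supp u \<Longrightarrow>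
      ((\<lambda>i. l2_inner g (\<phi>' i) * l2_inner (\<phi> i) u) has_sum l2_inner g u) UNIV"
  shows "dual_frames (\<lambda>i. inv_fourier (\<phi> i)) (\<lambda>i. inv_fourier (\<phi>' i))"
proof -
  note B0 = less_imp_le[OF B]
  have full: "(\<Sum>i\<in>F. (cmod (l2_inner f (inv_fourier (\<phi> i))))\<^sup>2) \<le> B * (l2_norm f)\<^sup>2"
    if "sq_int f" "finite F" for f F
    using that by (intro l2_inner_inv_fourier_sum_le \<phi> B0 bound)
  have full': "(\<Sum>i\<in>F. (cmod (l2_inner f (inv_fourier (\<phi>' i))))\<^sup>2) \<le> B * (l2_norm f)\<^sup>2"
    if "sq_int f" "finite F" for f F
    using that by (intro l2_inner_inv_fourier_sum_le \<phi>' B0 bound')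
  note sq = sq_int_inv_fourier[OF \<phi>] and sq' = sq_int_inv_fourier[OF \<phi>']
  have bessel: "bessel_seq (\<lambda>i. inv_fourier (\<phi> i))" by (rule bessel_seqI[OF sq B full])
  have bessel': "bessel_seq (\<lambda>i. inv_fourier (\<phi>' i))" by (rule bessel_seqI[OF sq' B full'])
  have "\<exists>F0. finite F0 \<and> (\<forall>F. finite F \<and> F0 \<subseteq> F \<longrightarrow>
      l2_norm (\<lambda>x. f x - (\<Sum>i\<in>F. l2_inner f (inv_fourier (\<phi>' i)) * inv_fourier (\<phi> i) x)) < e)"
    if f: "sq_int f" and e: "0 < e" for f e
  proof -
    \<comment> \<open>Error budget: \<open>r\<close> and its synthesised part cost at most
      \<open>d * (1 + B) = e / 2\<close>, the remainder for \<open>g\<close> at most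
      \<open>t * sqrt B = e / 4\<close>.\<close>
    define d where "d = e / 2 / (1 + B)"
    have "1 + B \<noteq> 0" using B by simp
    then have d: "d * (1 + B) = e / 2"
      using d_def by (rule nonzero_eq_divide_eq[THEN iffD1])
    have d_pos: "0 < d" using e B by (simp add: d_def)
    obtain g where g: "bdd_supp g" "l2_norm (\<lambda>x. f x - inv_fourier g x) < d"
      using inv_fourier_dense[OF f d_pos] by metis
    define r where "r = (\<lambda>x. f x - inv_fourier g x)"
    have r: "sq_int r" "l2_norm r < d"
      using g(2) by (auto simp: r_def intro: sq_int_diff f sq_int_inv_fourier g)
    define a where "a = (\<lambda>i. l2_inner g (\<phi>' i))"
    define t where "t = e / (4 * sqrt B)"
    have t: "0 < t" "t * sqrt B = e / 4" using e B by (auto simp: t_def)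
    have "(\<lambda>i. (cmod (a i))\<^sup>2) summable_on UNIV"
      unfolding a_def using bound'[OF g(1)]
      by (intro nonneg_bdd_above_summable_on bdd_aboveI2[where M = "B * (l2_norm g)\<^sup>2"]) auto
    then obtain S where S: "((\<lambda>i. (cmod (a i))\<^sup>2) has_sum S) UNIV" by (auto simp: summable_on_def)
    obtain F0 where F0: "finite F0" "\<And>K. finite K \<Longrightarrow> F0 \<subseteq> K \<Longrightarrow> dist (\<Sum>i\<in>K. (cmod (a i))\<^sup>2) S < t\<^sup>2"
      using tendstoD[OF S[unfolded has_sum_def], of "t\<^sup>2"] t(1) unfolding eventually_finite_subsets_at_top
      by auto
    have "l2_norm (\<lambda>x. f x - (\<Sum>i\<in>F. l2_inner f (inv_fourier (\<phi>' i)) * inv_fourier (\<phi> i) x)) < e"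
      if F: "finite F" "F0 \<subseteq> F" for F
    proof -
      have tail: "L2_set (\<lambda>i. cmod (a i)) K \<le> t" if K: "finite K" "K \<inter> F = {}" for K
      proof -
        have "(\<Sum>i\<in>F \<union> K. (cmod (a i))\<^sup>2) = (\<Sum>i\<in>F. (cmod (a i))\<^sup>2) + (\<Sum>i\<in>K. (cmod (a i))\<^sup>2)"
          using F K by (intro sum.union_disjoint) auto
        moreover have "(\<Sum>i\<in>F \<union> K. (cmod (a i))\<^sup>2) \<le> S"
          using F K by (intro finite_sum_le_has_sum[OF S]) auto
        moreover have "S - t\<^sup>2 < (\<Sum>i\<in>F. (cmod (a i))\<^sup>2)"
          using F0(2)[OF F] by (auto simp: dist_real_def)
        ultimately have "(\<Sum>i\<in>K. (cmod (a i))\<^sup>2) \<le> 1 * t\<^sup>2" by simp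
        from L2_set_le_of_sum_le[OF this] show ?thesis using t by simp
      qed
      define u where "u = (\<lambda>x. g x - (\<Sum>i\<in>F. a i * \<phi> i x))"
      have a\<phi>: "bdd_supp (\<lambda>x. a i * \<phi> i x)" for i by (intro bdd_supp_cmult \<phi>)
      have u: "bdd_supp u" unfolding u_def by (intro bdd_supp_diff g bdd_supp_sum a\<phi>)
      have u_norm: "l2_norm u \<le> e / 4"
        unfolding u_def t(2)[symmetric]
        by (rule weak_expansion_remainder[OF \<phi> g(1) B0 bound _ F(1) less_imp_le[OF t(1)] tail])
          (auto simp: a_def intro: weak[OF g(1)])
      have inv_u: "inv_fourier u = (\<lambda>x. inv_fourier g x - (\<Sum>i\<in>F. a i * inv_fourier (\<phi> i) x))"
        unfolding u_def by (simp add: inv_fourier_diff g bdd_supp_sum a\<phi> inv_fourier_sum inv_fourier_cmult)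
      define s where "s = (\<lambda>x. \<Sum>i\<in>F. l2_inner r (inv_fourier (\<phi>' i)) * inv_fourier (\<phi> i) x)"
      have s: "sq_int s" unfolding s_def by (intro sq_int_sum sq_int_cmult sq)
      have "l2_norm s \<le> sqrt B * L2_set (\<lambda>i. cmod (l2_inner r (inv_fourier (\<phi>' i)))) F"
        unfolding s_def by (rule synthesis_bound[OF sq B0 full[OF _ F(1)]])
      also have "\<dots> \<le> sqrt B * (sqrt B * l2_norm r)"
        using B0 by (intro mult_left_mono L2_set_le_of_sum_le full' r F) auto
      also have "\<dots> = B * l2_norm r" using B0 by simp
      also have "\<dots> \<le> B * d" using r(2) B0 by (intro mult_left_mono) auto
      finally have s_norm: "l2_norm s \<le> B * d" .
      have coeff: "l2_inner f (inv_fourier (\<phi>' i)) = a i + l2_inner r (inv_fourier (\<phi>' i))" for i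
        by (simp add: r_def a_def l2_inner_diff_left f sq_int_inv_fourier g \<phi>' plancherel_inner)
      have "(\<lambda>x. f x - (\<Sum>i\<in>F. l2_inner f (inv_fourier (\<phi>' i)) * inv_fourier (\<phi> i) x))
        = (\<lambda>x. (r x + inv_fourier u x) + (- 1) * s x)"
        unfolding coeff inv_u s_def by (simp add: r_def distrib_right sum.distrib algebra_simps)
      then have "l2_norm (\<lambda>x. f x - (\<Sum>i\<in>F. l2_inner f (inv_fourier (\<phi>' i)) * inv_fourier (\<phi> i) x))
        = l2_norm (\<lambda>x. (r x + inv_fourier u x) + (- 1) * s x)" by simp
      also have "\<dots> \<le> l2_norm (\<lambda>x. r x + inv_fourier u x) + l2_norm (\<lambda>x. (- 1) * s x)"
        by (intro l2_norm_triangle sq_int_add r sq_int_inv_fourier u sq_int_cmult s)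
      also have "\<dots> \<le> (l2_norm r + l2_norm (inv_fourier u)) + l2_norm (\<lambda>x. (- 1) * s x)"
        by (intro add_right_mono l2_norm_triangle r sq_int_inv_fourier u)
      also have "l2_norm (\<lambda>x. (- 1) * s x) = l2_norm s" by (simp only: l2_norm_cmult) simp
      also have "l2_norm r + l2_norm (inv_fourier u) + l2_norm s < d + e / 4 + B * d"
        using r(2) u_norm s_norm by (simp add: plancherel_norm u)
      also have "\<dots> = d * (1 + B) + e / 4" by (simp add: algebra_simps)
      also have "\<dots> < e" using d e by simp
      finally show ?thesis .
    qed
    then show ?thesis using F0(1) by blast
  qed
  then show ?thesis unfolding dual_frames_def using bessel bessel' by blast
qed

section \<open>Wavelet systems\<close>

lemma supp_in_dilate:
  assumes "supp_in R w" "0 < s" shows "supp_in (R / s) (\<lambda>x. w (s * x))"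
  unfolding supp_in_def
proof (intro allI impI)
  fix x assume "R / s < \<bar>x\<bar>"
  then have "R < \<bar>s * x\<bar>" using assms(2) by (simp add: abs_mult field_simps)
  then show "w (s * x) = 0" using assms(1) by (simp add: supp_in_def)
qed

lemma bdd_supp_iff_supp_in:
  "bdd_supp w \<longleftrightarrow> w \<in> borel_measurable borel \<and> (\<exists>C. \<forall>x. cmod (w x) \<le> C) \<and> (\<exists>R. supp_in R w)"
proof (intro iffI conjI)
  assume *: "w \<in> borel_measurable borel \<and> (\<exists>C. \<forall>x. cmod (w x) \<le> C) \<and> (\<exists>R. supp_in R w)"
  then obtain C R where C: "\<And>x. cmod (w x) \<le> C" and R: "supp_in R w" by blast
  have "cmod (w x) \<le> C * indicator {-R..R} x" for x
  proof (cases "x \<in> {-R..R}")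
    case False
    then have "R < \<bar>x\<bar>" by auto
    then show ?thesis using R False by (simp add: supp_in_def)
  qed (use C in simp)
  with * show "bdd_supp w" unfolding bdd_supp_def by blast
next
  assume w: "bdd_supp w"
  show "w \<in> borel_measurable borel" by (rule bdd_supp_measurable[OF w])
  show "\<exists>C. \<forall>x. cmod (w x) \<le> C" using bdd_supp_bounded[OF w] by metis
  show "\<exists>R. supp_in R w" using bdd_supp_supp_in[OF w] by metis
qed

lemma bdd_supp_dilate:
  assumes w: "bdd_supp w" and s: "0 < s" shows "bdd_supp (\<lambda>x. w (s * x))"
  using w supp_in_dilate[OF _ s] unfolding bdd_supp_iff_supp_in
  by (auto intro: measurable_compose[rotated])

text \<open>The Fourier transform of the wavelet with index \<open>(j, k)\<close> whose generator
  has transform \<open>w\<close>: dilation by \<open>c^j\<close> becomes dilation by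
  \<open>c^(-j)\<close>, and translation becomes modulation.\<close>

definition wavelet_hat :: "real \<Rightarrow> real \<Rightarrow> (real \<Rightarrow> complex) \<Rightarrow> int \<times> int \<Rightarrow> real \<Rightarrow> complex" where
  "wavelet_hat c b w = (\<lambda>(j, k) \<omega>. complex_of_real (c powr (- real_of_int j / 2)) *
     (w (c powr (- real_of_int j) * \<omega>) * cis (- (2 * pi * (real_of_int k * b * c powr (- real_of_int j))) * \<omega>)))"

text \<open>A linear substitution in the integral. The equality holds at every point, not just
  almost everywhere, so it can rewrite inside \<open>dual_frames\<close>.\<close>

lemma dil_transl_inv_fourier:
  assumes c: "0 < c"
  shows "dil c j (transl (real_of_int k * b) (inv_fourier w)) = inv_fourier (wavelet_hat c b w (j, k))"
proof
  fix x
  define s where "s = c powr (- real_of_int j)"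
  have s: "0 < s" using c by (simp add: s_def)
  have cs: "c powr real_of_int j * s = 1" using c by (simp add: s_def flip: powr_add)
  have half: "c powr (real_of_int j / 2) * s = c powr (- real_of_int j / 2)"
    by (simp add: s_def flip: powr_add)
  let ?y = "c powr real_of_int j * x - real_of_int k * b"
  have eq: "w (s * \<omega>) * cis (2 * pi * ?y * (s * \<omega>))
      = w (s * \<omega>) * cis (- (2 * pi * (real_of_int k * b * s)) * \<omega>) * cis (2 * pi * x * \<omega>)" for \<omega>
  proof -
    have "2 * pi * ?y * (s * \<omega>) = 2 * pi * x * \<omega> * (c powr real_of_int j * s) - 2 * pi * (real_of_int k * b * s) * \<omega>"
      by (simp add: algebra_simps)
    also have "\<dots> = - (2 * pi * (real_of_int k * b * s)) * \<omega> + 2 * pi * x * \<omega>" by (simp add: cs)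
    finally show ?thesis by (simp add: cis_mult mult.assoc)
  qed
  have "inv_fourier w ?y = s *\<^sub>R (LINT \<omega>|lborel. w (s * \<omega>) * cis (2 * pi * ?y * (s * \<omega>)))"
    unfolding inv_fourier_def
    using lborel_integral_real_affine[of s "\<lambda>\<gamma>. w \<gamma> * cis (2 * pi * ?y * \<gamma>)" 0] s by simp
  then have "dil c j (transl (real_of_int k * b) (inv_fourier w)) x
      = complex_of_real (c powr (real_of_int j / 2) * s) *
        (LINT \<omega>|lborel. w (s * \<omega>) * cis (- (2 * pi * (real_of_int k * b * s)) * \<omega>) * cis (2 * pi * x * \<omega>))"
    unfolding eq by (simp add: dil_def transl_def scaleR_conv_of_real)
  also have "\<dots> = inv_fourier (wavelet_hat c b w (j, k)) x"
    unfolding half inv_fourier_def wavelet_hat_def by (simp add: mult.assoc flip: s_def)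
  finally show "dil c j (transl (real_of_int k * b) (inv_fourier w)) x
      = inv_fourier (wavelet_hat c b w (j, k)) x" .
qed

lemma bdd_supp_wavelet_hat:
  assumes "bdd_supp w" "0 < c" shows "bdd_supp (wavelet_hat c b w i)"
proof (cases i)
  case (Pair j k)
  show ?thesis
    unfolding Pair wavelet_hat_def prod.case
    by (intro bdd_supp_cmult bdd_supp_modulate bdd_supp_dilate) (use assms in simp_all)
qed

text \<open>With \<open>s = c powr (- j)\<close>, the sampling point \<open>k * b * s\<close> is
  written as a quotient by \<open>1 / (b * s)\<close>, the period of the Fourier series belonging to
  level \<open>j\<close>.\<close>

lemma wavelet_hat_coeff:
  "l2_inner g (wavelet_hat c b w (j, k)) = complex_of_real (c powr (- real_of_int j / 2)) *
    inv_fourier (\<lambda>\<omega>. g \<omega> * cnj (w (c powr (- real_of_int j) * \<omega>)))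
      (real_of_int k / (1 / (b * c powr (- real_of_int j))))"
proof -
  let ?s = "c powr (- real_of_int j)"
  have "l2_inner g (wavelet_hat c b w (j, k)) = (LINT \<omega>|lborel. complex_of_real (c powr (- real_of_int j / 2)) *
      (g \<omega> * cnj (w (?s * \<omega>)) * cis (2 * pi * (real_of_int k / (1 / (b * ?s))) * \<omega>)))"
    unfolding l2_inner_def wavelet_hat_def
    by (rule Bochner_Integration.integral_cong) (simp_all add: cis_cnj mult_ac)
  then show ?thesis by (simp only: inv_fourier_def integral_mult_right_zero)
qed

text \<open>The support condition makes the dilates of \<open>w\<close> and \<open>w'\<close> fit
  into one period \<open>L = 1 / (b * s)\<close>, so there is no aliasing and Parseval applies to
  their products with \<open>u\<close> and \<open>g\<close>. The normalisation \<open>s\<close>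
  times \<open>L\<close> is \<open>1 / b\<close> on every level.\<close>

lemma wavelet_level_inner:
  assumes c: "0 < c" and b: "0 < b" and w: "bdd_supp w" "supp_in (1 / (2 * b)) w"
    and w': "bdd_supp w'" "supp_in (1 / (2 * b)) w'" and g: "bdd_supp g" and u: "bdd_supp u"
  shows "((\<lambda>k. l2_inner g (wavelet_hat c b w' (j, k)) * l2_inner (wavelet_hat c b w (j, k)) u) has_sum
    1 / complex_of_real b * (LINT \<omega>|lborel. g \<omega> * cnj (u \<omega>) *
      (cnj (w' (c powr (- real_of_int j) * \<omega>)) * w (c powr (- real_of_int j) * \<omega>)))) UNIV"
proof -
  define s where "s = c powr (- real_of_int j)"
  define L where "L = 1 / (b * s)"
  define r where "r = c powr (- real_of_int j / 2)"
  have s: "0 < s" using c by (simp add: s_def)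
  have L: "0 < L" using s b by (simp add: L_def)
  have rr: "r * r = s" by (simp add: r_def s_def flip: powr_add)
  have L2: "1 / (2 * b) / s = L / 2" by (simp add: L_def)
  define G where "G = (\<lambda>\<omega>. g \<omega> * cnj (w' (s * \<omega>)))"
  define U where "U = (\<lambda>\<omega>. u \<omega> * cnj (w (s * \<omega>)))"
  have "supp_in (L / 2) (\<lambda>\<omega>. w (s * \<omega>))" "supp_in (L / 2) (\<lambda>\<omega>. w' (s * \<omega>))"
    using supp_in_dilate[OF w(2) s] supp_in_dilate[OF w'(2) s] by (simp_all only: L2)
  then have supp: "supp_in (L / 2) G" "supp_in (L / 2) U" by (auto simp: supp_in_def G_def U_def)
  have bs: "bdd_supp G" "bdd_supp U"
    unfolding G_def U_def by (intro bdd_supp_mult g u bdd_supp_cnj bdd_supp_dilate w w' s)+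
  have "((\<lambda>k. complex_of_real s * (inv_fourier G (real_of_int k / L) * cnj (inv_fourier U (real_of_int k / L))))
      has_sum complex_of_real s * (L * l2_inner G U)) UNIV"
    by (intro has_sum_cmult_right fourier_series_inner bs supp L)
  moreover have "complex_of_real s * (inv_fourier G (real_of_int k / L) * cnj (inv_fourier U (real_of_int k / L)))
      = l2_inner g (wavelet_hat c b w' (j, k)) * l2_inner (wavelet_hat c b w (j, k)) u" for k
  proof -
    have "l2_inner (wavelet_hat c b w (j, k)) u = cnj (complex_of_real r * inv_fourier U (real_of_int k / L))"
      by (subst l2_inner_commute) (simp only: wavelet_hat_coeff U_def s_def L_def r_def)
    moreover have "l2_inner g (wavelet_hat c b w' (j, k)) = complex_of_real r * inv_fourier G (real_of_int k / L)"
      by (simp only: wavelet_hat_coeff G_def s_def L_def r_def)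
    ultimately show ?thesis by (simp add: rr[symmetric] mult_ac)
  qed
  moreover have "complex_of_real s * (L * l2_inner G U) = 1 / complex_of_real b * l2_inner G U"
    using s by (simp add: L_def)
  moreover have "l2_inner G U = (LINT \<omega>|lborel. g \<omega> * cnj (u \<omega>) * (cnj (w' (s * \<omega>)) * w (s * \<omega>)))"
    unfolding l2_inner_def G_def U_def by (simp add: mult_ac)
  ultimately show ?thesis by (simp only: s_def)
qed

lemma wavelet_level_norm:
  assumes c: "0 < c" and b: "0 < b" and w: "bdd_supp w" "supp_in (1 / (2 * b)) w" and g: "bdd_supp g"
  shows "((\<lambda>k. (cmod (l2_inner g (wavelet_hat c b w (j, k))))\<^sup>2) has_sum
    (LINT \<omega>|lborel. (cmod (g \<omega>))\<^sup>2 * (cmod (w (c powr (- real_of_int j) * \<omega>)))\<^sup>2) / b) UNIV"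
proof -
  let ?s = "c powr (- real_of_int j)"
  have "((\<lambda>k. complex_of_real ((cmod (l2_inner g (wavelet_hat c b w (j, k))))\<^sup>2)) has_sum
      1 / complex_of_real b * (LINT \<omega>|lborel. g \<omega> * cnj (g \<omega>) * (cnj (w (?s * \<omega>)) * w (?s * \<omega>)))) UNIV"
    using wavelet_level_inner[OF c b w w g g, of j]
    by (subst (asm) l2_inner_commute) (simp only: complex_norm_square)
  also have "(LINT \<omega>|lborel. g \<omega> * cnj (g \<omega>) * (cnj (w (?s * \<omega>)) * w (?s * \<omega>)))
      = complex_of_real (LINT \<omega>|lborel. (cmod (g \<omega>))\<^sup>2 * (cmod (w (?s * \<omega>)))\<^sup>2)"
    unfolding integral_complex_of_real[symmetric]
    by (intro Bochner_Integration.integral_cong) (simp_all add: complex_norm_square mult_ac del: of_real_power)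
  finally show ?thesis by (simp flip: has_sum_of_real_iff[where 'a = complex])
qed

text \<open>After \<open>F\<close> is enclosed in a rectangle of indices, Parseval bounds the
  translations of each level by an integral, and \<open>C\<close> bounds the sum over levels under
  the integral sign.\<close>

lemma wavelet_bessel_bound:
  assumes c: "0 < c" and b: "0 < b" and w: "bdd_supp w" "supp_in (1 / (2 * b)) w" and g: "bdd_supp g"
    and C: "\<And>J \<omega>. finite J \<Longrightarrow> (\<Sum>j\<in>J. (cmod (w (c powr (- real_of_int j) * \<omega>)))\<^sup>2) \<le> C"
    and F: "finite F"
  shows "(\<Sum>i\<in>F. (cmod (l2_inner g (wavelet_hat c b w i)))\<^sup>2) \<le> C / b * (l2_norm g)\<^sup>2"
proof -
  note lev = wavelet_level_norm[OF c b w g]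
  define J where "J = fst ` F"
  define K where "K = snd ` F"
  have fin: "finite J" "finite K" using F by (auto simp: J_def K_def)
  have int: "integrable lborel (\<lambda>\<omega>. (cmod (g \<omega>))\<^sup>2 * (cmod (w (c powr (- real_of_int j) * \<omega>)))\<^sup>2)" for j
  proof -
    have "bdd_supp (\<lambda>\<omega>. g \<omega> * w (c powr (- real_of_int j) * \<omega>))"
      by (intro bdd_supp_mult g bdd_supp_dilate w) (use c in simp)
    from sq_int_integrable[OF bdd_supp_sq_int[OF this]] show ?thesis
      by (simp add: norm_mult power_mult_distrib)
  qed
  have "(\<Sum>i\<in>F. (cmod (l2_inner g (wavelet_hat c b w i)))\<^sup>2)
      \<le> (\<Sum>i\<in>J \<times> K. (cmod (l2_inner g (wavelet_hat c b w i)))\<^sup>2)"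
    using fin by (intro sum_mono2) (force simp: J_def K_def)+
  also have "\<dots> = (\<Sum>j\<in>J. \<Sum>k\<in>K. (cmod (l2_inner g (wavelet_hat c b w (j, k))))\<^sup>2)"
    by (simp add: sum.cartesian_product)
  also have "\<dots> \<le> (\<Sum>j\<in>J. (LINT \<omega>|lborel. (cmod (g \<omega>))\<^sup>2 * (cmod (w (c powr (- real_of_int j) * \<omega>)))\<^sup>2) / b)"
    using fin by (intro sum_mono finite_sum_le_has_sum[OF lev]) auto
  also have "\<dots> = (LINT \<omega>|lborel. (\<Sum>j\<in>J. (cmod (g \<omega>))\<^sup>2 * (cmod (w (c powr (- real_of_int j) * \<omega>)))\<^sup>2)) / b"
    using int by (simp add: sum_divide_distrib)
  also have "\<dots> \<le> (LINT \<omega>|lborel. C * (cmod (g \<omega>))\<^sup>2) / b"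
  proof (intro divide_right_mono integral_mono)
    show "integrable lborel (\<lambda>\<omega>. C * (cmod (g \<omega>))\<^sup>2)"
      using sq_int_integrable[OF bdd_supp_sq_int[OF g]] by simp
    show "integrable lborel (\<lambda>\<omega>. \<Sum>j\<in>J. (cmod (g \<omega>))\<^sup>2 * (cmod (w (c powr (- real_of_int j) * \<omega>)))\<^sup>2)"
      using int by simp
    fix \<omega>
    show "(\<Sum>j\<in>J. (cmod (g \<omega>))\<^sup>2 * (cmod (w (c powr (- real_of_int j) * \<omega>)))\<^sup>2) \<le> C * (cmod (g \<omega>))\<^sup>2"
      unfolding sum_distrib_left[symmetric] using C[OF fin(1), of \<omega>]
      by (subst mult.commute) (intro mult_right_mono, auto)
  qed (use b in simp)
  also have "\<dots> = C / b * (l2_norm g)\<^sup>2" by (simp add: l2_norm_sq)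
  finally show ?thesis .
qed

text \<open>Summing the weak expansion over translations and then over levels multiplies
  \<open>g * cnj u\<close> by \<open>1 / b\<close> times the sum in \<open>dual\<close>, that is, by
  1.\<close>

theorem dual_wavelet_frames:
  assumes c: "0 < c" and b: "0 < b" and w: "bdd_supp w" "supp_in (1 / (2 * b)) w"
    and w': "bdd_supp w'" "supp_in (1 / (2 * b)) w'"
    and C: "\<And>J \<omega>. finite J \<Longrightarrow> (\<Sum>j\<in>J. (cmod (w (c powr (- real_of_int j) * \<omega>)))\<^sup>2) \<le> C"
    and C': "\<And>J \<omega>. finite J \<Longrightarrow> (\<Sum>j\<in>J. (cmod (w' (c powr (- real_of_int j) * \<omega>)))\<^sup>2) \<le> C"
    and dual: "\<And>\<omega>. \<omega> \<noteq> 0 \<Longrightarrow> ((\<lambda>j. cnj (w' (c powr (- real_of_int j) * \<omega>)) * w (c powr (- real_of_int j) * \<omega>))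
      has_sum complex_of_real b) UNIV"
  shows "dual_frames (\<lambda>(j, k). dil c j (transl (real_of_int k * b) (inv_fourier w)))
    (\<lambda>(j, k). dil c j (transl (real_of_int k * b) (inv_fourier w')))"
proof -
  \<comment> \<open>The 1 keeps the bound positive even for \<open>C = 0\<close>.\<close>
  define B where "B = (C + 1) / b"
  have C0: "0 \<le> C" using C[of "{}"] by simp
  have B: "0 < B" using C0 b by (simp add: B_def)
  have CB: "C / b * (l2_norm g)\<^sup>2 \<le> B * (l2_norm g)\<^sup>2" for g
    using b by (intro mult_right_mono) (auto simp: B_def divide_right_mono)
  have bound: "(\<Sum>i\<in>F. (cmod (l2_inner g (wavelet_hat c b w i)))\<^sup>2) \<le> B * (l2_norm g)\<^sup>2"
    if "bdd_supp g" "finite F" for g F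
    using that by (intro order_trans[OF wavelet_bessel_bound CB] c b w C)
  have bound': "(\<Sum>i\<in>F. (cmod (l2_inner g (wavelet_hat c b w' i)))\<^sup>2) \<le> B * (l2_norm g)\<^sup>2"
    if "bdd_supp g" "finite F" for g F
    using that by (intro order_trans[OF wavelet_bessel_bound CB] c b w' C')
  have weak: "((\<lambda>i. l2_inner g (wavelet_hat c b w' i) * l2_inner (wavelet_hat c b w i) u) has_sum l2_inner g u) UNIV"
    if g: "bdd_supp g" and u: "bdd_supp u" for g u
  proof -
    define f where "f = (\<lambda>i. l2_inner g (wavelet_hat c b w' i) * l2_inner (wavelet_hat c b w i) u)"
    \<comment> \<open>The two Bessel bounds give absolute summability. So some total
      \<open>S\<close> exists and may be computed level by level; its value is identified at the end
      by uniqueness of limits.\<close>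
    have abs_summ: "(\<lambda>i. norm (f i)) summable_on UNIV"
    proof (rule nonneg_bdd_above_summable_on)
      show "bdd_above (sum (\<lambda>i. norm (f i)) ` {F. F \<subseteq> UNIV \<and> finite F})"
      proof (rule bdd_aboveI2)
        fix F assume "F \<in> {F :: (int \<times> int) set. F \<subseteq> UNIV \<and> finite F}"
        then have F: "finite F" by simp
        have "norm (f i) \<le> (cmod (l2_inner g (wavelet_hat c b w' i)))\<^sup>2 + (cmod (l2_inner u (wavelet_hat c b w i)))\<^sup>2" for i
        proof -
          have "norm (f i) = cmod (l2_inner g (wavelet_hat c b w' i)) * cmod (l2_inner u (wavelet_hat c b w i))"
            unfolding f_def norm_mult by (subst l2_inner_commute[of _ u]) simp
          moreover have "0 \<le> cmod (l2_inner g (wavelet_hat c b w' i)) * cmod (l2_inner u (wavelet_hat c b w i))"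
            by simp
          ultimately show ?thesis
            using sum_squares_bound[of "cmod (l2_inner g (wavelet_hat c b w' i))" "cmod (l2_inner u (wavelet_hat c b w i))"]
            by linarith
        qed
        then have "(\<Sum>i\<in>F. norm (f i)) \<le> (\<Sum>i\<in>F. (cmod (l2_inner g (wavelet_hat c b w' i)))\<^sup>2)
            + (\<Sum>i\<in>F. (cmod (l2_inner u (wavelet_hat c b w i)))\<^sup>2)"
          unfolding sum.distrib[symmetric] by (rule sum_mono)
        also have "\<dots> \<le> B * (l2_norm g)\<^sup>2 + B * (l2_norm u)\<^sup>2"
          by (intro add_mono bound bound' g u F)
        finally show "(\<Sum>i\<in>F. norm (f i)) \<le> B * (l2_norm g)\<^sup>2 + B * (l2_norm u)\<^sup>2" .
      qed
    qed simp
    then obtain S where S: "(f has_sum S) UNIV"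
      using abs_summable_summable[OF abs_summ] by (auto simp: summable_on_def)
    define q where "q = (\<lambda>j \<omega>. cnj (w' (c powr (- real_of_int j) * \<omega>)) * w (c powr (- real_of_int j) * \<omega>))"
    define I where "I = (\<lambda>j. LINT \<omega>|lborel. g \<omega> * cnj (u \<omega>) * q j \<omega>)"
    have "((\<lambda>j. 1 / complex_of_real b * I j) has_sum S) UNIV"
    proof (rule has_sum_SigmaD[where f = f and B = "\<lambda>_. UNIV"])
      show "(f has_sum S) (UNIV \<times> UNIV)" using S by simp
      show "((\<lambda>k. f (j, k)) has_sum 1 / complex_of_real b * I j) UNIV" for j
        unfolding f_def I_def q_def by (rule wavelet_level_inner[OF c b w w' g u])
    qed
    then have "((\<lambda>n. 1 / complex_of_real b * I (int_decode n)) has_sum S) UNIV"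
      using has_sum_reindex_bij_betw[OF bij_int_decode, of "\<lambda>j. 1 / complex_of_real b * I j"] by simp
    then have "(\<lambda>n. 1 / complex_of_real b * I (int_decode n)) sums S" by (rule has_sum_imp_sums)
    then have lim1: "(\<lambda>N. \<Sum>n<N. 1 / complex_of_real b * I (int_decode n)) \<longlonglongrightarrow> S" by (simp add: sums_def)
    have gu: "bdd_supp (\<lambda>\<omega>. g \<omega> * cnj (u \<omega>))" by (intro bdd_supp_mult g bdd_supp_cnj u)
    have q_bs: "bdd_supp (q j)" for j
      unfolding q_def using c by (intro bdd_supp_mult bdd_supp_cnj bdd_supp_dilate w w') simp_all
    note [measurable] = bdd_supp_measurable[OF g] bdd_supp_measurable[OF u] bdd_supp_measurable[OF q_bs]
    \<comment> \<open>Sums the levels under the integral. The partial sums are dominated through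
      \<open>x * y \<le> x^2 + y^2\<close> and the two bounds by \<open>C\<close>; the excluded
      point 0 is a null set.\<close>
    have "(\<lambda>N. LINT \<omega>|lborel. g \<omega> * cnj (u \<omega>) * (\<Sum>n<N. q (int_decode n) \<omega>))
        \<longlonglongrightarrow> (LINT \<omega>|lborel. g \<omega> * cnj (u \<omega>) * complex_of_real b)"
    proof (rule integral_dominated_convergence[where w = "\<lambda>\<omega>. (2 * C) * cmod (g \<omega> * cnj (u \<omega>))"])
      show "integrable lborel (\<lambda>\<omega>. (2 * C) * cmod (g \<omega> * cnj (u \<omega>)))"
        using integrable_norm[OF bdd_supp_integrable[OF gu]] by simp
      have "AE \<omega> in lborel. \<omega> \<noteq> (0 :: real)" by (rule AE_lborel_singleton)
      then show "AE \<omega> in lborel. (\<lambda>N. g \<omega> * cnj (u \<omega>) * (\<Sum>n<N. q (int_decode n) \<omega>))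
          \<longlonglongrightarrow> g \<omega> * cnj (u \<omega>) * complex_of_real b"
      proof eventually_elim
        case (elim \<omega>)
        have "((\<lambda>j. q j \<omega>) has_sum complex_of_real b) UNIV"
          unfolding q_def by (rule dual[OF elim])
        then have "((\<lambda>n. q (int_decode n) \<omega>) has_sum complex_of_real b) UNIV"
          using has_sum_reindex_bij_betw[OF bij_int_decode, of "\<lambda>j. q j \<omega>"] by simp
        then have "(\<lambda>N. \<Sum>n<N. q (int_decode n) \<omega>) \<longlonglongrightarrow> complex_of_real b"
          using has_sum_imp_sums by (auto simp: sums_def)
        then show ?case by (intro tendsto_intros)
      qed
      show "AE \<omega> in lborel. norm (g \<omega> * cnj (u \<omega>) * (\<Sum>n<N. q (int_decode n) \<omega>)) \<le> (2 * C) * cmod (g \<omega> * cnj (u \<omega>))" for N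
      proof (rule AE_I2)
        fix \<omega>
        let ?J = "int_decode ` {..<N}"
        have "(\<Sum>n<N. q (int_decode n) \<omega>) = (\<Sum>j\<in>?J. q j \<omega>)"
          by (subst sum.reindex) (auto intro: inj_on_subset[OF inj_int_decode])
        also have "norm \<dots> \<le> (\<Sum>j\<in>?J. (cmod (w' (c powr (- real_of_int j) * \<omega>)))\<^sup>2 + (cmod (w (c powr (- real_of_int j) * \<omega>)))\<^sup>2)"
        proof (rule sum_norm_le)
          fix j
          let ?x = "cmod (w' (c powr (- real_of_int j) * \<omega>))" and ?y = "cmod (w (c powr (- real_of_int j) * \<omega>))"
          have "0 \<le> ?x * ?y" by simp
          then have "?x * ?y \<le> ?x\<^sup>2 + ?y\<^sup>2" using sum_squares_bound[of ?x ?y] by linarith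
          then show "norm (q j \<omega>) \<le> ?x\<^sup>2 + ?y\<^sup>2" by (simp add: q_def norm_mult)
        qed
        also have "\<dots> \<le> C + C" unfolding sum.distrib by (intro add_mono C C') auto
        finally have "norm (\<Sum>n<N. q (int_decode n) \<omega>) \<le> 2 * C" by simp
        then show "norm (g \<omega> * cnj (u \<omega>) * (\<Sum>n<N. q (int_decode n) \<omega>)) \<le> (2 * C) * cmod (g \<omega> * cnj (u \<omega>))"
          unfolding norm_mult[of _ "sum _ _"] by (subst mult.commute) (intro mult_right_mono, auto)
      qed
    qed measurable
    moreover have "(LINT \<omega>|lborel. g \<omega> * cnj (u \<omega>) * (\<Sum>n<N. q (int_decode n) \<omega>)) = (\<Sum>n<N. I (int_decode n))" for N
      unfolding I_def sum_distrib_left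
      by (rule Bochner_Integration.integral_sum) (intro bdd_supp_integrable bdd_supp_mult[OF gu q_bs])
    moreover have "(LINT \<omega>|lborel. g \<omega> * cnj (u \<omega>) * complex_of_real b) = l2_inner g u * complex_of_real b"
      by (simp add: l2_inner_def)
    ultimately have "(\<lambda>N. \<Sum>n<N. I (int_decode n)) \<longlonglongrightarrow> l2_inner g u * complex_of_real b"
      by (simp only:)
    then have "(\<lambda>N. 1 / complex_of_real b * (\<Sum>n<N. I (int_decode n)))
        \<longlonglongrightarrow> 1 / complex_of_real b * (l2_inner g u * complex_of_real b)"
      by (rule tendsto_mult_left)
    then have "(\<lambda>N. \<Sum>n<N. 1 / complex_of_real b * I (int_decode n)) \<longlonglongrightarrow> l2_inner g u"
      using b by (simp add: sum_distrib_left)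
    with lim1 have "S = l2_inner g u" by (rule LIMSEQ_unique)
    then show ?thesis using S by (simp add: f_def)
  qed
  have "dual_frames (\<lambda>i. inv_fourier (wavelet_hat c b w i)) (\<lambda>i. inv_fourier (wavelet_hat c b w' i))"
    by (intro dual_frames_inv_fourierI[OF _ _ B] bdd_supp_wavelet_hat w w' c bound bound' weak)
  then show ?thesis by (simp add: dil_transl_inv_fourier[OF c] case_prod_unfold)
qed

section \<open>The functions \<open>h\<^sub>n\<close>\<close>

lemma Sset_iff: "0 < c \<Longrightarrow> x \<in> Sset c \<longleftrightarrow> c < \<bar>x\<bar> \<and> \<bar>x\<bar> \<le> 1"
  unfolding Sset_def by auto

lemma Sset_measurable [measurable]: "Sset c \<in> sets borel"
  unfolding Sset_def by measurable

text \<open>Logarithms turn the condition into a half-open interval of length \<open>n\<close> for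
  \<open>j\<close>, the negative \<open>ln c\<close> reversing the inequalities. Hence two
  admissible levels always differ by less than \<open>n\<close>.\<close>

lemma dilation_level_iff:
  fixes j :: int
  assumes c: "0 < c" "c < 1" and y: "0 < y"
  shows "c ^ n < c powr real_of_int j * y \<and> c powr real_of_int j * y \<le> 1
    \<longleftrightarrow> - ln y / ln c \<le> real_of_int j \<and> real_of_int j < real n + (- ln y / ln c)"
proof -
  have l: "ln c < 0" using c by simp
  have pos: "0 < c powr real_of_int j * y" using c y by simp
  have ln: "ln (c powr real_of_int j * y) = real_of_int j * ln c + ln y"
    using c y by (simp add: ln_mult ln_powr)
  have "c ^ n < c powr real_of_int j * y \<longleftrightarrow> real n * ln c < real_of_int j * ln c + ln y"
    using ln_less_cancel_iff[of "c ^ n" "c powr real_of_int j * y"] pos c by (simp add: ln ln_realpow)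
  moreover have "c powr real_of_int j * y \<le> 1 \<longleftrightarrow> real_of_int j * ln c + ln y \<le> 0"
    using ln_le_zero_iff[OF pos] by (simp add: ln)
  ultimately show ?thesis using l by (auto simp: field_simps)
qed

lemma dilation_level_finite:
  assumes "0 < c" "c < 1" "0 < y"
  shows "finite {j :: int. c ^ n < c powr real_of_int j * y \<and> c powr real_of_int j * y \<le> 1}"
proof (rule finite_subset)
  show "{j :: int. c ^ n < c powr real_of_int j * y \<and> c powr real_of_int j * y \<le> 1}
      \<subseteq> {\<lfloor>- ln y / ln c\<rfloor> .. \<lceil>real n + (- ln y / ln c)\<rceil>}"
    unfolding dilation_level_iff[OF assms]
    by (auto simp: le_ceiling_iff floor_le_iff)
qed simp

text \<open>A half-open interval of length 1, closed on the left, contains one integer: its left end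
  rounded up.\<close>

lemma dilation_level_one:
  assumes "0 < c" "c < 1" "0 < y"
  shows "c < c powr real_of_int j * y \<and> c powr real_of_int j * y \<le> 1 \<longleftrightarrow> j = \<lceil>- ln y / ln c\<rceil>"
  using dilation_level_iff[OF assms, of 1 j] unfolding eq_commute[of j] ceiling_eq_iff
  by (simp only: power_one_right of_nat_1) linarith

text \<open>Proved jointly because the induction step feeds on several of the properties at once. A
  nonzero integrand needs \<open>|t|\<close> above \<open>c^(n+1)\<close> and
  \<open>|x| / |t|\<close> above \<open>c\<close>, which adds one factor \<open>c\<close> to the
  support; the integral of the previous function bounds the next one, and bound and support give
  integrability.\<close>

lemma hfun_props:
  assumes c: "0 < c" "c < 1"
  shows "hfun c (Suc n) \<in> borel_measurable borel \<and> (\<forall>x. 0 \<le> hfun c (Suc n) x)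
    \<and> (\<forall>x. hfun c (Suc n) x \<noteq> 0 \<longrightarrow> c ^ Suc n < \<bar>x\<bar> \<and> \<bar>x\<bar> \<le> 1) \<and> integrable lborel (hfun c (Suc n))
    \<and> (\<exists>M. \<forall>x. hfun c (Suc n) x \<le> M)"
proof (induction n)
  case 0
  have "emeasure lborel (Sset c) \<le> emeasure lborel {-1..1::real}"
    using c by (intro emeasure_mono) (auto simp: Sset_def)
  then have "emeasure lborel (Sset c) < \<infinity>" by (simp add: order_le_less_trans)
  then have "integrable lborel (indicator (Sset c) :: real \<Rightarrow> real)"
    by (intro integrable_real_indicator) auto
  moreover have "c < \<bar>x\<bar> \<and> \<bar>x\<bar> \<le> 1" if "indicator (Sset c) x \<noteq> (0 :: real)" for x
    using that Sset_iff[OF c(1)] by (metis indicator_simps(2))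
  moreover have "indicator (Sset c) x \<le> (1 :: real)" for x by (rule indicator_le_1)
  ultimately show ?case unfolding hfun.simps power_one_right
    by (intro conjI allI impI exI[of _ 1]) auto
next
  case (Suc n)
  let ?h = "hfun c (Suc n)" and ?H = "hfun c (Suc (Suc n))"
  from Suc have [measurable]: "?h \<in> borel_measurable borel" and nonneg: "\<And>x. 0 \<le> ?h x"
    and supp: "\<And>x. ?h x \<noteq> 0 \<Longrightarrow> c ^ Suc n < \<bar>x\<bar> \<and> \<bar>x\<bar> \<le> 1" and int: "integrable lborel ?h"
    by auto
  have H_meas [measurable]: "?H \<in> borel_measurable borel" by (simp, measurable)
  have H_nonneg: "0 \<le> ?H x" for x by (simp add: nonneg)
  have H_supp: "c ^ Suc (Suc n) < \<bar>x\<bar> \<and> \<bar>x\<bar> \<le> 1" if "?H x \<noteq> 0" for x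
  proof (rule ccontr)
    assume x: "\<not> (c ^ Suc (Suc n) < \<bar>x\<bar> \<and> \<bar>x\<bar> \<le> 1)"
    have "?h t * indicator (Sset c) (x / \<bar>t\<bar>) = 0" for t
    proof (rule ccontr)
      assume "?h t * indicator (Sset c) (x / \<bar>t\<bar>) \<noteq> 0"
      then have t: "?h t \<noteq> 0" "x / \<bar>t\<bar> \<in> Sset c" by (auto simp: indicator_def split: if_splits)
      from supp[OF t(1)] have ct: "c ^ Suc n < \<bar>t\<bar>" "\<bar>t\<bar> \<le> 1" by auto
      have "0 < c ^ Suc n" using c by simp
      then have "0 < \<bar>t\<bar>" using ct by linarith
      then have "c * \<bar>t\<bar> < \<bar>x\<bar>" "\<bar>x\<bar> \<le> \<bar>t\<bar>"
        using t(2) unfolding Sset_iff[OF c(1)] by (simp_all add: abs_divide field_simps)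
      moreover have "c * c ^ Suc n < c * \<bar>t\<bar>" using ct c by (intro mult_strict_left_mono)
      ultimately show False using x ct by simp
    qed
    then have "?H x = 0" by (simp only: hfun.simps Bochner_Integration.integral_zero)
    then show False using that by contradiction
  qed
  have H_bd: "?H x \<le> (LINT t|lborel. ?h t)" for x
  proof -
    have "(LINT t|lborel. ?h t * indicator (Sset c) (x / \<bar>t\<bar>)) \<le> (LINT t|lborel. ?h t)"
    proof (rule integral_mono)
      show "integrable lborel (\<lambda>t. ?h t * indicator (Sset c) (x / \<bar>t\<bar>))"
        by (rule Bochner_Integration.integrable_bound[OF int]) (auto simp: indicator_def)
      show "?h t * indicator (Sset c) (x / \<bar>t\<bar>) \<le> ?h t" for t
        using nonneg[of t] by (auto simp: indicator_def)
    qed (rule int)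
    then show ?thesis by simp
  qed
  have "integrable lborel ?H"
  proof (rule Bochner_Integration.integrable_bound)
    show "integrable lborel (\<lambda>x. (LINT t|lborel. ?h t) * indicator {-1..1::real} x :: real)"
      by (intro integrable_mult_right integrable_real_indicator) (auto simp: emeasure_lborel_Icc_eq)
    show "AE x in lborel. norm (?H x) \<le> norm ((LINT t|lborel. ?h t) * indicator {-1..1::real} x)"
    proof (rule AE_I2)
      fix x
      show "norm (?H x) \<le> norm ((LINT t|lborel. ?h t) * indicator {-1..1} x)"
      proof (cases "?H x = 0")
        case False
        then have "x \<in> {-1..1}" using H_supp[OF False] by auto
        then show ?thesis using H_bd[of x] H_nonneg[of x] by (simp del: hfun.simps)
      qed simp
    qed
  qed (simp del: hfun.simps)
  then show ?case
    by (intro conjI allI impI exI[of _ "LINT t|lborel. ?h t"] H_meas H_nonneg H_bd) (drule H_supp, simp)+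
qed

text \<open>A zero integral would make \<open>h\<close> vanish a.e., hence a.e. along all countably
  many dilates at once, against the positive sum. This gives positivity of \<open>Qnum\<close> with
  no explicit evaluation.\<close>

lemma integral_pos_of_dilation_sum:
  assumes c: "0 < c" and h: "h \<in> borel_measurable borel" "\<And>x. 0 \<le> h x" "integrable lborel h"
    and q: "0 < q" and sum: "\<And>y. y \<noteq> 0 \<Longrightarrow> ((\<lambda>j. h (c powr real_of_int j * y)) has_sum q) (UNIV :: int set)"
  shows "0 < (LINT x|lborel. h x :: real)"
proof (rule ccontr)
  note [measurable] = h(1)
  assume "\<not> 0 < (LINT x|lborel. h x)"
  then have "(LINT x|lborel. h x) = 0"
    using Bochner_Integration.integral_nonneg[of lborel h] h(2) by (simp add: antisym)
  then have "AE x in lborel. h x = 0"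
    using integral_nonneg_eq_0_iff_AE[OF h(3)] h(2) by simp
  then have "AE x in lborel. h (0 + c powr real_of_int j * x) = 0" for j :: int
    using c by (intro AE_borel_affine) (simp, measurable)
  then have "AE x in lborel. \<forall>j :: int. h (c powr real_of_int j * x) = 0"
    by (simp add: AE_all_countable)
  moreover have "AE x in lborel. x \<noteq> (0 :: real)" by (rule AE_lborel_singleton)
  ultimately have "AE x in (lborel :: real measure). False"
  proof eventually_elim
    case (elim x)
    then have "((\<lambda>j :: int. 0 :: real) has_sum q) UNIV" using sum[of x] by simp
    then show ?case using q has_sum_unique[OF _ has_sum_0_simp] by fastforce
  qed
  then show False
    using ae_filter_eq_bot_iff[of "lborel :: real measure"] by (simp add: trivial_limit_def)
qed

lemma Sset_dilation_sum:
  assumes c: "0 < c" "c < 1" and y: "y \<noteq> 0" and J: "finite J" "\<lceil>- ln \<bar>y\<bar> / ln c\<rceil> \<in> J"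
  shows "(\<Sum>j\<in>J. indicator (Sset c) (c powr real_of_int j * y)) = (1 :: real)"
proof -
  have "indicator (Sset c) (c powr real_of_int j * y) = (if j = \<lceil>- ln \<bar>y\<bar> / ln c\<rceil> then 1 else (0 :: real))" for j
    using dilation_level_one[OF c, of "\<bar>y\<bar>" j] y c by (auto simp: indicator_def Sset_iff abs_mult)
  then show ?thesis using J by simp
qed

lemma hfun_dilation_sum:
  assumes c: "0 < c" "c < 1" and y: "y \<noteq> 0"
  shows "((\<lambda>j. hfun c (Suc (Suc m)) (c powr real_of_int j * y)) has_sum Qnum c (Suc m)) UNIV"
proof -
  let ?h = "hfun c (Suc m)"
  have [measurable]: "?h \<in> borel_measurable borel" and int: "integrable lborel ?h"
    and supp: "\<And>x. ?h x \<noteq> 0 \<Longrightarrow> c ^ Suc m < \<bar>x\<bar> \<and> \<bar>x\<bar> \<le> 1"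
    using hfun_props[OF c, of m] by auto
  \<comment> \<open>A finite range that depends on \<open>y\<close> but not on \<open>t\<close>: for
    every \<open>t\<close> in the support of \<open>?h\<close> the single level \<open>j0\<close>
    selected by the tiling lies in it. So only a finite sum is exchanged with the integral.\<close>
  define J where "J = {j :: int. c ^ Suc (Suc m) < c powr real_of_int j * \<bar>y\<bar> \<and> c powr real_of_int j * \<bar>y\<bar> \<le> 1}"
  have fin: "finite J" unfolding J_def using c y by (intro dilation_level_finite) auto
  have "(\<Sum>j\<in>J. ?h t * indicator (Sset c) (c powr real_of_int j * y / \<bar>t\<bar>)) = ?h t" for t
  proof (cases "?h t = 0")
    case False
    from supp[OF False] have ct: "c ^ Suc m < \<bar>t\<bar>" "\<bar>t\<bar> \<le> 1" by auto
    have "0 < c ^ Suc m" using c by simp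
    then have t: "0 < \<bar>t\<bar>" using ct by linarith
    define z where "z = y / \<bar>t\<bar>"
    define j0 where "j0 = \<lceil>- ln \<bar>z\<bar> / ln c\<rceil>"
    have z: "z \<noteq> 0" "\<bar>z\<bar> = \<bar>y\<bar> / \<bar>t\<bar>" using y t by (auto simp: z_def abs_divide)
    then have "c < c powr real_of_int j0 * \<bar>z\<bar> \<and> c powr real_of_int j0 * \<bar>z\<bar> \<le> 1"
      using dilation_level_one[OF c, of "\<bar>z\<bar>" j0] by (simp add: j0_def)
    then have "c * \<bar>t\<bar> < c powr real_of_int j0 * \<bar>y\<bar>" "c powr real_of_int j0 * \<bar>y\<bar> \<le> \<bar>t\<bar>"
      unfolding z(2) using t by (auto simp: field_simps)
    moreover have "c * c ^ Suc m < c * \<bar>t\<bar>" using ct c by (intro mult_strict_left_mono)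
    ultimately have "j0 \<in> J" using ct by (simp add: J_def)
    then have "(\<Sum>j\<in>J. indicator (Sset c) (c powr real_of_int j * z)) = (1 :: real)"
      unfolding j0_def by (intro Sset_dilation_sum c z fin)
    then show ?thesis unfolding sum_distrib_left[symmetric] by (simp add: z_def)
  qed simp
  then have "Qnum c (Suc m) = (LINT t|lborel. (\<Sum>j\<in>J. ?h t * indicator (Sset c) (c powr real_of_int j * y / \<bar>t\<bar>)))"
    by (simp add: Qnum_def)
  also have "\<dots> = (\<Sum>j\<in>J. LINT t|lborel. ?h t * indicator (Sset c) (c powr real_of_int j * y / \<bar>t\<bar>))"
    by (rule Bochner_Integration.integral_sum)
      (rule Bochner_Integration.integrable_bound[OF int], measurable, auto simp: indicator_def)
  also have "\<dots> = (\<Sum>j\<in>J. hfun c (Suc (Suc m)) (c powr real_of_int j * y))" by simp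
  finally have Q: "Qnum c (Suc m) = (\<Sum>j\<in>J. hfun c (Suc (Suc m)) (c powr real_of_int j * y))" .
  show ?thesis
  proof (rule has_sum_finite_neutralI[OF fin _ _ Q])
    fix j assume "j \<in> UNIV - J"
    then show "hfun c (Suc (Suc m)) (c powr real_of_int j * y) = 0"
      using hfun_props[OF c, of "Suc m"] by (auto simp: J_def abs_mult simp del: hfun.simps)
  qed simp
qed

text \<open>Positivity propagates because the dilation sum of the next function is the current
  \<open>Qnum\<close>; at the start the tiling by \<open>Sset c\<close> gives the sum 1.\<close>

lemma Qnum_pos:
  assumes c: "0 < c" "c < 1"
  shows "0 < Qnum c (Suc m)"
proof (induction m)
  case 0
  have "((\<lambda>j. hfun c (Suc 0) (c powr real_of_int j * y)) has_sum 1) (UNIV :: int set)" if y: "y \<noteq> 0" for y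
  proof (rule has_sum_finite_neutralI[of "{\<lceil>- ln \<bar>y\<bar> / ln c\<rceil>}"])
    fix j assume "j \<in> UNIV - {\<lceil>- ln \<bar>y\<bar> / ln c\<rceil>}"
    then show "hfun c (Suc 0) (c powr real_of_int j * y) = 0"
      using dilation_level_one[OF c, of "\<bar>y\<bar>" j] y c by (auto simp: indicator_def Sset_iff abs_mult)
  next
    show "1 = (\<Sum>j\<in>{\<lceil>- ln \<bar>y\<bar> / ln c\<rceil>}. hfun c (Suc 0) (c powr real_of_int j * y))"
      using Sset_dilation_sum[OF c y, of "{\<lceil>- ln \<bar>y\<bar> / ln c\<rceil>}"] by simp
  qed simp_all
  then show ?case
    unfolding Qnum_def using hfun_props[OF c, of 0] c
    by (intro integral_pos_of_dilation_sum[of c _ 1]) auto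
next
  case (Suc m)
  then show ?case
    unfolding Qnum_def[of c "Suc (Suc m)"] using hfun_props[OF c, of "Suc m"] c hfun_dilation_sum[OF c, of _ m]
    by (intro integral_pos_of_dilation_sum[of c _ "Qnum c (Suc m)"]) (auto simp del: hfun.simps)
qed

theorem theorem4p3:
  fixes c b :: real and n :: nat
  assumes "0 < c" and "c < 1" and "2 \<le> n" and "0 < b" and "b \<le> c ^ (n - 1) / 2"
  shows "dual_frames
           (\<lambda>(j::int, k::int). dil c j (transl (real_of_int k * b) (inv_fourier (psi_hat c n))))
           (\<lambda>(j::int, k::int). dil c j (transl (real_of_int k * b) (inv_fourier (psit_hat c n b))))"
proof -
  note c = assms(1,2) and b = assms(4,5)
  define m where "m = n - 2"
  have n: "n = Suc (Suc m)" using assms(3) by (simp add: m_def)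
  define h where "h = hfun c n"
  define Q where "Q = Qnum c (n - 1)"
  define M where "M = {- int n + 1 .. int n - 1}"
  have h_meas [measurable]: "h \<in> borel_measurable borel" and h0: "\<And>x. 0 \<le> h x"
    and h_supp: "\<And>x. h x \<noteq> 0 \<Longrightarrow> c ^ n < \<bar>x\<bar> \<and> \<bar>x\<bar> \<le> 1" and "\<exists>H. \<forall>x. h x \<le> H"
    using hfun_props[OF c, of "Suc m"] by (auto simp: h_def n simp del: hfun.simps)
  then obtain H where H: "\<And>x. h x \<le> H" by blast
  have Q: "0 < Q" using Qnum_pos[OF c, of m] by (simp add: Q_def n)
  \<comment> \<open>Reindexed by \<open>- j\<close>, the sign with which levels appear on the
    frequency side.\<close>
  have h_sum: "((\<lambda>j. h (c powr (- real_of_int j) * y)) has_sum Q) UNIV" if "y \<noteq> 0" for y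
  proof -
    have "((\<lambda>j. h (c powr real_of_int j * y)) has_sum Q) UNIV"
      using hfun_dilation_sum[OF c that, of m] by (simp add: h_def n Q_def del: hfun.simps)
    then show ?thesis
      using has_sum_reindex_bij_betw[of uminus UNIV UNIV "\<lambda>j. h (c powr real_of_int j * y)"]
      by (simp add: bij_uminus)
  qed
  have h_le: "(\<Sum>j\<in>J. h (c powr (- real_of_int j) * y)) \<le> Q" if "finite J" for J y
  proof (cases "y = 0")
    case True
    have "\<not> c ^ n < \<bar>0\<bar>" using c by (simp add: not_less)
    then have "h 0 = 0" using h_supp[of 0] by blast
    then show ?thesis using True Q by simp
  next
    case False
    then show ?thesis using that h0 by (intro finite_sum_le_has_sum[OF h_sum]) auto
  qed
  \<comment> \<open>The l2 norm is at most the l1 norm, so the linear tiling sums already bound the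
    sums of squares behind the Bessel property.\<close>
  have sum_sq: "(\<Sum>j\<in>J. (f j)\<^sup>2) \<le> T\<^sup>2" if "\<And>j. 0 \<le> f j" "(\<Sum>j\<in>J. f j) \<le> T" for f :: "int \<Rightarrow> real" and J T
    using L2_set_le_sum[of J f] that unfolding L2_set_def by (intro sqrt_le_D) simp
  define ht where "ht = (\<lambda>x. b / Q\<^sup>2 * (\<Sum>i\<in>M. h (c powr real_of_int i * x)))"
  have psi: "psi_hat c n = (\<lambda>x. complex_of_real (h x))" by (simp add: psi_hat_def h_def)
  have psit: "psit_hat c n b = (\<lambda>x. complex_of_real (ht x))"
    by (simp only: psit_hat_def ht_def Q_def M_def h_def)
  have ht_meas [measurable]: "ht \<in> borel_measurable borel" unfolding ht_def by measurable
  have ht0: "0 \<le> ht x" for x unfolding ht_def using b h0 by (intro mult_nonneg_nonneg sum_nonneg) auto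
  have ht_bd: "ht x \<le> b / Q\<^sup>2 * (real (card M) * H)" for x
  proof -
    have "(\<Sum>i\<in>M. h (c powr real_of_int i * x)) \<le> (\<Sum>i\<in>M. H)" by (intro sum_mono H)
    then show ?thesis unfolding ht_def using b by (intro mult_left_mono) auto
  qed
  have cn: "c ^ (n - 1) \<le> 1" "0 < c ^ (n - 1)" using c by (auto simp: power_le_one)
  \<comment> \<open>The support radii of the second and of the first generator, both within half a
    period; the first inequality is the hypothesis on \<open>b\<close> rearranged.\<close>
  have R: "1 / c ^ (n - 1) \<le> 1 / (2 * b)" "1 \<le> 1 / (2 * b)"
    using b cn by (auto simp: field_simps)
  have supp: "supp_in (1 / (2 * b)) (psi_hat c n)"
    unfolding supp_in_def psi
  proof (intro allI impI)
    fix x assume "1 / (2 * b) < \<bar>x\<bar>"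
    then have "\<not> \<bar>x\<bar> \<le> 1" using R(2) by linarith
    then show "complex_of_real (h x) = 0" using h_supp[of x] by auto
  qed
  have supp': "supp_in (1 / (2 * b)) (psit_hat c n b)"
    unfolding supp_in_def psit
  proof (intro allI impI)
    fix x assume x: "1 / (2 * b) < \<bar>x\<bar>"
    have "h (c powr real_of_int i * x) = 0" if "i \<in> M" for i
    proof (rule ccontr)
      assume "h (c powr real_of_int i * x) \<noteq> 0"
      from h_supp[OF this] have "c powr real_of_int i * \<bar>x\<bar> \<le> 1" by (simp add: abs_mult)
      \<comment> \<open>Since \<open>c < 1\<close>, the widest dilate is the one with
        \<open>i = n - 1\<close>.\<close>
      moreover have "c ^ (n - 1) \<le> c powr real_of_int i"
      proof -
        have "real_of_int i \<le> real (n - 1)" using that by (auto simp: M_def n)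
        then have "c powr real (n - 1) \<le> c powr real_of_int i" using c by (intro powr_mono') auto
        then show ?thesis using c by (simp add: powr_realpow)
      qed
      then have "c ^ (n - 1) * \<bar>x\<bar> \<le> c powr real_of_int i * \<bar>x\<bar>" by (intro mult_right_mono) auto
      ultimately have "\<bar>x\<bar> \<le> 1 / c ^ (n - 1)" using cn by (simp add: field_simps)
      with R(1) x show False by linarith
    qed
    then show "complex_of_real (ht x) = 0" by (simp add: ht_def)
  qed
  have w: "bdd_supp (psi_hat c n)"
    unfolding bdd_supp_iff_supp_in
  proof (intro conjI exI allI)
    show "cmod (psi_hat c n x) \<le> H" for x using h0 H by (simp add: psi)
    show "supp_in (1 / (2 * b)) (psi_hat c n)" by (rule supp)
  qed (simp add: psi)
  have w': "bdd_supp (psit_hat c n b)"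
    unfolding bdd_supp_iff_supp_in
  proof (intro conjI exI allI)
    show "cmod (psit_hat c n b x) \<le> b / Q\<^sup>2 * (real (card M) * H)" for x
      using ht0 ht_bd by (simp add: psit)
    show "supp_in (1 / (2 * b)) (psit_hat c n b)" by (rule supp')
  qed (simp add: psit)
  \<comment> \<open>Each of the \<open>card M\<close> dilates in \<open>ht\<close> contributes at
    most \<open>Q\<close> to a sum over levels.\<close>
  define T where "T = b / Q\<^sup>2 * (real (card M) * Q)"
  have ht_le: "(\<Sum>j\<in>J. ht (c powr (- real_of_int j) * y)) \<le> T" if J: "finite J" for J y
  proof -
    have "(\<Sum>j\<in>J. ht (c powr (- real_of_int j) * y))
        = b / Q\<^sup>2 * (\<Sum>i\<in>M. \<Sum>j\<in>J. h (c powr (- real_of_int j) * (c powr real_of_int i * y)))"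
      unfolding ht_def sum_distrib_left[symmetric] by (subst sum.swap) (simp add: mult.left_commute)
    also have "\<dots> \<le> b / Q\<^sup>2 * (\<Sum>i\<in>M. Q)"
      using b J by (intro mult_left_mono sum_mono h_le) auto
    finally show ?thesis by (simp add: T_def)
  qed
  have dual: "((\<lambda>j. cnj (psit_hat c n b (c powr (- real_of_int j) * y)) * psi_hat c n (c powr (- real_of_int j) * y))
      has_sum complex_of_real b) UNIV" if y: "y \<noteq> 0" for y
  proof -
    define a where "a = (\<lambda>j :: int. h (c powr (- real_of_int j) * y))"
    have aQ: "(a has_sum Q) UNIV" unfolding a_def by (rule h_sum[OF y])
    have level: "- ln \<bar>y\<bar> / ln c \<le> - real_of_int j \<and> - real_of_int j < real n + (- ln \<bar>y\<bar> / ln c)"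
      if "a j \<noteq> 0" for j
      using h_supp[of "c powr (- real_of_int j) * y"] that dilation_level_iff[OF c, of "\<bar>y\<bar>" n "- j"] y
      by (simp add: a_def abs_mult)
    \<comment> \<open>If \<open>a j\<close> is nonzero, \<open>level\<close> puts every nonzero
      level at distance at most \<open>n - 1\<close> from \<open>j\<close>, exactly the reach of
      \<open>M\<close>; the window sum is then the full sum \<open>Q\<close>.\<close>
    have "ht (c powr (- real_of_int j) * y) * a j = b / Q * a j" for j
    proof (cases "a j = 0")
      case False
      have "(\<Sum>i\<in>M. h (c powr real_of_int i * (c powr (- real_of_int j) * y))) = (\<Sum>i\<in>M. a (j - i))"
        unfolding a_def mult.assoc[symmetric] by (simp flip: powr_add)
      also have "\<dots> = (\<Sum>l\<in>(\<lambda>i. j - i) ` M. a l)" by (subst sum.reindex) (auto simp: inj_on_def)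
      also have "\<dots> = Q"
      proof -
        have "(a has_sum (\<Sum>l\<in>(\<lambda>i. j - i) ` M. a l)) UNIV"
        proof (rule has_sum_finite_neutralI)
          fix l assume l: "l \<in> UNIV - (\<lambda>i. j - i) ` M"
          show "a l = 0"
          proof (rule ccontr)
            assume "a l \<noteq> 0"
            from level[OF this] level[OF False]
            have "real_of_int (j - l) < real n" "real_of_int (l - j) < real n" by simp_all
            then have "j - l \<in> M" by (auto simp: M_def)
            then have "l \<in> (\<lambda>i. j - i) ` M" by (intro image_eqI[of _ _ "j - l"]) auto
            with l show False by simp
          qed
        qed (auto simp: M_def)
        with aQ show ?thesis by (rule has_sum_unique[rotated])
      qed
      finally show ?thesis using Q by (simp add: ht_def power2_eq_square)
    qed simp
    then have "(\<lambda>j. cnj (psit_hat c n b (c powr (- real_of_int j) * y)) * psi_hat c n (c powr (- real_of_int j) * y))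
      = (\<lambda>j. complex_of_real (b / Q * a j))"
      by (simp add: psi psit a_def flip: of_real_mult)
    moreover have "((\<lambda>j. complex_of_real (b / Q * a j)) has_sum complex_of_real (b / Q * Q)) UNIV"
      by (intro has_sum_of_real has_sum_cmult_right aQ)
    ultimately show ?thesis using Q by simp
  qed
  show ?thesis
  proof (rule dual_wavelet_frames[OF c(1) b(1) w supp w' supp' _ _ dual])
    fix J :: "int set" and y :: real assume J: "finite J"
    have "(\<Sum>j\<in>J. (cmod (psi_hat c n (c powr (- real_of_int j) * y)))\<^sup>2) \<le> Q\<^sup>2"
      using sum_sq[OF h0 h_le[OF J]] h0 by (simp add: psi)
    then show "(\<Sum>j\<in>J. (cmod (psi_hat c n (c powr (- real_of_int j) * y)))\<^sup>2) \<le> max (Q\<^sup>2) (T\<^sup>2)"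
      by simp
    have "(\<Sum>j\<in>J. (cmod (psit_hat c n b (c powr (- real_of_int j) * y)))\<^sup>2) \<le> T\<^sup>2"
      using sum_sq[OF ht0 ht_le[OF J]] ht0 by (simp add: psit)
    then show "(\<Sum>j\<in>J. (cmod (psit_hat c n b (c powr (- real_of_int j) * y)))\<^sup>2) \<le> max (Q\<^sup>2) (T\<^sup>2)"
      by simp
  qed
qed

end
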